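(* Let $A$ be a non-trivial group, $C,C'$ subgroups of $A$, $\varphi:C\to C'$ an isomorphism, and let $$G=A_{*\varphi}=\langle A,t\mid tct^{-1}=\varphi(c)\ \text{for all } c\in C\rangle$$ be the HNN extension. Let $\widetilde C$ be the largest subgroup of $C\cap C'$ that is normal in $G$. - If the HNN extension is non-degenerate, then $G$ is icc if and only if (i) $FC_G(\widetilde C)=\{1\}$. - If the HNN extension is degenerate, then $G$ is icc if and only if both (i) $FC_G(\widetilde C)=\{1\}$ holds and (ii) the homomorphism $\Theta:\mathbb{Z}\to\mathrm{Out}(A)$ is injective.
   Context: A group is icc if it is infinite and all of its conjugacy classes except $\{1\}$ are infinite. The HNN extension is called degenerate when $A=C=C'$, and non-degenerate otherwise. For a normal subgroup $N$ of $G$, $FC_G(N)$ is the set of elements of $N$ whose $G$-conjugacy class is finite. In the degenerate case $\widetilde C=A$, $A$ is the kernel of the epimorphism $G\to\mathbb{Z}$ that kills $A$ and sends $t$ to the generator $1$, and $\Theta:\mathbb{Z}\to\mathrm{Out}(A)$ is the associated homomorphism, sending $1$ to the class of the automorphism $x\mapsto txt^{-1}$ of $A$. *)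

theory Defs
  imports "HOL-Algebra.Elementary_Groups" "HOL-Algebra.Bij"
begin

section \<open>Conjugacy classes, icc groups, FC-parts\<close>

definition conj_class :: "('a, 'm) monoid_scheme \<Rightarrow> 'a \<Rightarrow> 'a set" where
  "conj_class G x = {g \<otimes>\<^bsub>G\<^esub> x \<otimes>\<^bsub>G\<^esub> inv\<^bsub>G\<^esub> g | g. g \<in> carrier G}"

definition icc :: "('a, 'm) monoid_scheme \<Rightarrow> bool" where
  "icc G \<longleftrightarrow> infinite (carrier G) \<and> (\<forall>x \<in> carrier G - {\<one>\<^bsub>G\<^esub>}. infinite (conj_class G x))"

definition FC :: "('a, 'm) monoid_scheme \<Rightarrow> 'a set \<Rightarrow> 'a set" where
  "FC G N = {x \<in> N. finite (conj_class G x)}"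


section \<open>Outer automorphisms\<close>

definition conj_map :: "('a, 'm) monoid_scheme \<Rightarrow> 'a set \<Rightarrow> 'a \<Rightarrow> 'a \<Rightarrow> 'a" where
  "conj_map G N g = (\<lambda>x \<in> N. g \<otimes>\<^bsub>G\<^esub> x \<otimes>\<^bsub>G\<^esub> inv\<^bsub>G\<^esub> g)"

definition Inn :: "('a, 'm) monoid_scheme \<Rightarrow> ('a \<Rightarrow> 'a) set" where
  "Inn H = conj_map H (carrier H) ` carrier H"

definition Out :: "('a, 'm) monoid_scheme \<Rightarrow> ('a \<Rightarrow> 'a) set monoid" where
  "Out H = AutoGroup H Mod Inn H"

text \<open>The action of \<open>G\<close> by conjugation on a normal subgroup \<open>N\<close>, modulo inner automorphisms
  of \<open>N\<close>.\<close>

definition outer_action :: "('a, 'm) monoid_scheme \<Rightarrow> 'a set \<Rightarrow> 'a \<Rightarrow> ('a \<Rightarrow> 'a) set" where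
  "outer_action G N g =
     Inn (G\<lparr>carrier := N\<rparr>) #>\<^bsub>AutoGroup (G\<lparr>carrier := N\<rparr>)\<^esub> conj_map G N g"

lemma (in group) inv_cancel_left:
  assumes "g \<in> carrier G" "x \<in> carrier G"
  shows "g \<otimes> (inv g \<otimes> x) = x" "inv g \<otimes> (g \<otimes> x) = x"
  using assms by (simp_all flip: m_assoc)

lemma (in group) conj_map_auto:
  assumes "N \<lhd> G" "g \<in> carrier G"
  shows "conj_map G N g \<in> auto (G\<lparr>carrier := N\<rparr>)"
proof -
  have sub: "subgroup N G" and cl: "\<And>x h. x \<in> carrier G \<Longrightarrow> h \<in> N \<Longrightarrow> x \<otimes> h \<otimes> inv x \<in> N"
    using assms(1) normal_inv_iff by auto
  note NG = subgroup.mem_carrier[OF sub]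
  have hom: "conj_map G N g \<in> hom (G\<lparr>carrier := N\<rparr>) (G\<lparr>carrier := N\<rparr>)"
  proof (rule homI)
    fix x y assume "x \<in> carrier (G\<lparr>carrier := N\<rparr>)" "y \<in> carrier (G\<lparr>carrier := N\<rparr>)"
    then show "conj_map G N g (x \<otimes>\<^bsub>G\<lparr>carrier := N\<rparr>\<^esub> y) =
        conj_map G N g x \<otimes>\<^bsub>G\<lparr>carrier := N\<rparr>\<^esub> conj_map G N g y"
      using assms(2) NG subgroup.m_closed[OF sub]
      by (simp add: conj_map_def m_assoc inv_cancel_left)
  qed (use cl assms(2) in \<open>auto simp: conj_map_def\<close>)
  have "bij_betw (conj_map G N g) N N"
  proof (rule bij_betw_byWitness[where f' = "conj_map G N (inv g)"])
    show "\<forall>a\<in>N. conj_map G N (inv g) (conj_map G N g a) = a"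
      "\<forall>a\<in>N. conj_map G N g (conj_map G N (inv g) a) = a"
      using assms(2) NG cl[of g] cl[of "inv g"] by (auto simp: conj_map_def m_assoc inv_cancel_left)
    show "conj_map G N g ` N \<subseteq> N" "conj_map G N (inv g) ` N \<subseteq> N"
      using assms(2) cl[of g] cl[of "inv g"] by (auto simp: conj_map_def)
  qed
  then show ?thesis
    using hom by (simp add: auto_def Bij_def) (simp add: conj_map_def)
qed

lemma (in group) conj_map_mult:
  assumes "N \<lhd> G" "g \<in> carrier G" "h \<in> carrier G"
  shows "conj_map G N (g \<otimes> h) = conj_map G N g \<otimes>\<^bsub>AutoGroup (G\<lparr>carrier := N\<rparr>)\<^esub> conj_map G N h"
proof -
  have sub: "subgroup N G" and cl: "\<And>x h. x \<in> carrier G \<Longrightarrow> h \<in> N \<Longrightarrow> x \<otimes> h \<otimes> inv x \<in> N"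
    using assms(1) normal_inv_iff by auto
  note NG = subgroup.mem_carrier[OF sub]
  have bij: "conj_map G N g \<in> Bij N" "conj_map G N h \<in> Bij N"
    using conj_map_auto[OF assms(1)] assms(2,3) by (auto simp: auto_def)
  have "conj_map G N (g \<otimes> h) = compose N (conj_map G N g) (conj_map G N h)"
    using assms(2,3) NG cl[of h]
    by (auto simp: conj_map_def compose_def m_assoc inv_mult_group fun_eq_iff)
  then show ?thesis
    using bij by (simp add: AutoGroup_def BijGroup_def)
qed

lemma (in group) Inn_normal: "Inn G \<lhd> AutoGroup G"
proof -
  interpret AG: group "AutoGroup G" by (rule AutoGroup)
  have self: "carrier G \<lhd> G" using normal_inv_iff subgroup_self by auto
  have carr: "carrier (AutoGroup G) = auto G" by (simp add: AutoGroup_def)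
  have hom: "conj_map G (carrier G) \<in> hom G (AutoGroup G)"
    using conj_map_auto[OF self] conj_map_mult[OF self] by (auto intro!: homI simp: carr)
  interpret gh: group_hom G "AutoGroup G" "conj_map G (carrier G)"
    by unfold_locales (rule hom)
  have sub: "subgroup (Inn G) (AutoGroup G)"
    unfolding Inn_def by (rule gh.img_is_subgroup)
  show ?thesis
  proof (rule AG.normal_invI[OF sub])
    fix f k assume f: "f \<in> carrier (AutoGroup G)" and k: "k \<in> Inn G"
    obtain g where g: "g \<in> carrier G" and kg: "k = conj_map G (carrier G) g"
      using k by (auto simp: Inn_def)
    have fB: "f \<in> Bij (carrier G)" and fh: "f \<in> hom G G"
      using f by (auto simp: carr auto_def)
    have fc: "\<And>x. x \<in> carrier G \<Longrightarrow> f x \<in> carrier G" using fh hom_in_carrier by fastforce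
    interpret f: group_hom G G f by unfold_locales (rule fh)
    have kB: "conj_map G (carrier G) y \<in> Bij (carrier G)" if "y \<in> carrier G" for y
      using conj_map_auto[OF self that] by (auto simp: auto_def)
    have "f \<otimes>\<^bsub>AutoGroup G\<^esub> k = conj_map G (carrier G) (f g) \<otimes>\<^bsub>AutoGroup G\<^esub> f"
      using fB kB g fc
      by (auto simp: AutoGroup_def BijGroup_def kg compose_def conj_map_def fun_eq_iff)
    then have "f \<otimes>\<^bsub>AutoGroup G\<^esub> k \<otimes>\<^bsub>AutoGroup G\<^esub> inv\<^bsub>AutoGroup G\<^esub> f = conj_map G (carrier G) (f g)"
      using f fc[OF g] gh.hom_closed by (simp add: AG.m_assoc)
    then show "f \<otimes>\<^bsub>AutoGroup G\<^esub> k \<otimes>\<^bsub>AutoGroup G\<^esub> inv\<^bsub>AutoGroup G\<^esub> f \<in> Inn G"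
      using fc[OF g] by (auto simp: Inn_def)
  qed
qed

lemma (in group) outer_action_hom:
  assumes "N \<lhd> G"
  shows "outer_action G N \<in> hom G (Out (G\<lparr>carrier := N\<rparr>))"
proof -
  interpret N: group "G\<lparr>carrier := N\<rparr>"
    using assms normal_imp_subgroup subgroup_imp_group by blast
  interpret I: normal "Inn (G\<lparr>carrier := N\<rparr>)" "AutoGroup (G\<lparr>carrier := N\<rparr>)"
    by (rule N.Inn_normal)
  have "conj_map G N \<in> hom G (AutoGroup (G\<lparr>carrier := N\<rparr>))"
    using conj_map_auto[OF assms] conj_map_mult[OF assms]
    by (auto intro!: homI simp: AutoGroup_def)
  from Group.hom_compose[OF this I.r_coset_hom_Mod]
  show ?thesis by (simp add: Out_def outer_action_def[abs_def] comp_def)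
qed


section \<open>HNN extensions\<close>

datatype 'a letter = Base 'a | Stable | Stable_inv

definition hnn_words :: "('a, 'm) monoid_scheme \<Rightarrow> 'a letter list set" where
  "hnn_words A = lists (Base ` carrier A \<union> {Stable, Stable_inv})"

text \<open>The congruence on words presenting
  \<open>\<langle>A, t | t c t\<^sup>-\<^sup>1 = \<phi> c for all c \<in> C\<rangle>\<close>. The rules \<open>base_one\<close> and \<open>base_mult\<close> say that
  \<open>A\<close> enters with its own relations, and \<open>right_inv\<close>, \<open>left_inv\<close> that \<open>Stable\<close> and \<open>Stable_inv\<close>
  stand for \<open>t\<close> and \<open>t\<^sup>-\<^sup>1\<close>; inverses of letters from \<open>A\<close> are then automatic.\<close>

inductive hnn_cong ::
  "('a, 'm) monoid_scheme \<Rightarrow> 'a set \<Rightarrow> ('a \<Rightarrow> 'a) \<Rightarrow> 'a letter list \<Rightarrow> 'a letter list \<Rightarrow> bool"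
  for A :: "('a, 'm) monoid_scheme" and C :: "'a set" and \<phi> :: "'a \<Rightarrow> 'a" where
  refl: "u \<in> hnn_words A \<Longrightarrow> hnn_cong A C \<phi> u u"
| sym: "hnn_cong A C \<phi> u v \<Longrightarrow> hnn_cong A C \<phi> v u"
| trans: "hnn_cong A C \<phi> u v \<Longrightarrow> hnn_cong A C \<phi> v w \<Longrightarrow> hnn_cong A C \<phi> u w"
| append: "hnn_cong A C \<phi> u u' \<Longrightarrow> hnn_cong A C \<phi> v v' \<Longrightarrow> hnn_cong A C \<phi> (u @ v) (u' @ v')"
| base_one: "hnn_cong A C \<phi> [Base \<one>\<^bsub>A\<^esub>] []"
| base_mult: "a \<in> carrier A \<Longrightarrow> b \<in> carrier A \<Longrightarrow>
    hnn_cong A C \<phi> [Base a, Base b] [Base (a \<otimes>\<^bsub>A\<^esub> b)]"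
| right_inv: "hnn_cong A C \<phi> [Stable, Stable_inv] []"
| left_inv: "hnn_cong A C \<phi> [Stable_inv, Stable] []"
| stable_conj: "c \<in> C \<Longrightarrow> hnn_cong A C \<phi> [Stable, Base c, Stable_inv] [Base (\<phi> c)]"

definition hnn_class ::
  "('a, 'm) monoid_scheme \<Rightarrow> 'a set \<Rightarrow> ('a \<Rightarrow> 'a) \<Rightarrow> 'a letter list \<Rightarrow> 'a letter list set" where
  "hnn_class A C \<phi> u = {v. hnn_cong A C \<phi> u v}"

definition HNN ::
  "('a, 'm) monoid_scheme \<Rightarrow> 'a set \<Rightarrow> ('a \<Rightarrow> 'a) \<Rightarrow> 'a letter list set monoid" where
  "HNN A C \<phi> =
    \<lparr>carrier = hnn_class A C \<phi> ` hnn_words A,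
     mult = (\<lambda>U V. \<Union>u\<in>U. \<Union>v\<in>V. hnn_class A C \<phi> (u @ v)),
     one = hnn_class A C \<phi> []\<rparr>"

definition hnn_base :: "('a, 'm) monoid_scheme \<Rightarrow> 'a set \<Rightarrow> ('a \<Rightarrow> 'a) \<Rightarrow> 'a \<Rightarrow> 'a letter list set" where
  "hnn_base A C \<phi> a = hnn_class A C \<phi> [Base a]"

definition hnn_t :: "('a, 'm) monoid_scheme \<Rightarrow> 'a set \<Rightarrow> ('a \<Rightarrow> 'a) \<Rightarrow> 'a letter list set" where
  "hnn_t A C \<phi> = hnn_class A C \<phi> [Stable]"

definition hnn_degenerate :: "('a, 'm) monoid_scheme \<Rightarrow> 'a set \<Rightarrow> 'a set \<Rightarrow> bool" where
  "hnn_degenerate A C C' \<longleftrightarrow> carrier A = C \<and> C = C'"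

text \<open>The subgroup \<open>C~\<close>; subgroups of \<open>A\<close> are identified with their images under
  \<^term>\<open>hnn_base A C \<phi>\<close>. \<open>GREATEST\<close> is with respect to inclusion, and the greatest element
  exists by \<open>hnn_core_greatest\<close> below.\<close>

definition hnn_core ::
  "('a, 'm) monoid_scheme \<Rightarrow> 'a set \<Rightarrow> 'a set \<Rightarrow> ('a \<Rightarrow> 'a) \<Rightarrow> 'a letter list set set" where
  "hnn_core A C C' \<phi> =
     (GREATEST N. N \<lhd> HNN A C \<phi> \<and> N \<subseteq> hnn_base A C \<phi> ` (C \<inter> C'))"

text \<open>The subgroup \<open>A\<close> of \<open>G\<close>, as a group.\<close>

definition hnn_base_group ::
  "('a, 'm) monoid_scheme \<Rightarrow> 'a set \<Rightarrow> ('a \<Rightarrow> 'a) \<Rightarrow> 'a letter list set monoid" where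
  "hnn_base_group A C \<phi> = HNN A C \<phi>\<lparr>carrier := hnn_base A C \<phi> ` carrier A\<rparr>"

text \<open>In the degenerate case, \<open>A\<close> is normal in \<open>G\<close> and \<open>t ^ k\<close> is a lift of \<open>k\<close> along the
  epimorphism of \<open>G\<close> onto the integers with kernel \<open>A\<close>.\<close>

definition hnn_Theta ::
  "('a, 'm) monoid_scheme \<Rightarrow> 'a set \<Rightarrow> ('a \<Rightarrow> 'a) \<Rightarrow> int
     \<Rightarrow> ('a letter list set \<Rightarrow> 'a letter list set) set" where
  "hnn_Theta A C \<phi> k =
     outer_action (HNN A C \<phi>) (hnn_base A C \<phi> ` carrier A) (hnn_t A C \<phi> [^]\<^bsub>HNN A C \<phi>\<^esub> k)"

locale hnn_data = A: group A
  for A :: "('a, 'm) monoid_scheme" (structure) and C C' :: "'a set" and \<phi> :: "'a \<Rightarrow> 'a" +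
  assumes C_subgroup: "subgroup C A" and C'_subgroup: "subgroup C' A"
    and \<phi>_iso: "\<phi> \<in> iso (A\<lparr>carrier := C\<rparr>) (A\<lparr>carrier := C'\<rparr>)"
begin

abbreviation "G \<equiv> HNN A C \<phi>"
abbreviation "cls \<equiv> hnn_class A C \<phi>"
abbreviation "\<iota> \<equiv> hnn_base A C \<phi>"
abbreviation "t \<equiv> hnn_t A C \<phi>"

lemma \<phi>_mem: "c \<in> C \<Longrightarrow> \<phi> c \<in> C'"
  using \<phi>_iso by (auto simp: iso_def hom_def)

lemma C_mem: "c \<in> C \<Longrightarrow> c \<in> carrier A" and C'_mem: "c \<in> C' \<Longrightarrow> c \<in> carrier A"
  using subgroup.mem_carrier[OF C_subgroup] subgroup.mem_carrier[OF C'_subgroup] by simp_all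

lemma cong_words: "hnn_cong A C \<phi> u v \<Longrightarrow> u \<in> hnn_words A \<and> v \<in> hnn_words A"
  by (induction rule: hnn_cong.induct) (auto simp: hnn_words_def C_mem C'_mem \<phi>_mem)

lemma cls_eq: "u \<in> hnn_words A \<Longrightarrow> cls u = cls v \<longleftrightarrow> hnn_cong A C \<phi> u v"
  using hnn_cong.refl hnn_cong.sym hnn_cong.trans unfolding hnn_class_def set_eq_iff mem_Collect_eq
  by metis

lemma words_append: "u \<in> hnn_words A \<Longrightarrow> v \<in> hnn_words A \<Longrightarrow> u @ v \<in> hnn_words A"
  by (auto simp: hnn_words_def)

lemma cls_mult:
  assumes "u \<in> hnn_words A" "v \<in> hnn_words A"
  shows "cls u \<otimes>\<^bsub>G\<^esub> cls v = cls (u @ v)"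
proof -
  have "cls (u' @ v') = cls (u @ v)" if "u' \<in> cls u" "v' \<in> cls v" for u' v'
  proof -
    have "hnn_cong A C \<phi> (u @ v) (u' @ v')"
      using that by (auto simp: hnn_class_def intro: hnn_cong.append)
    then show ?thesis using cls_eq words_append[OF assms] by metis
  qed
  moreover have "u \<in> cls u" "v \<in> cls v"
    using assms by (auto simp: hnn_class_def intro: hnn_cong.refl)
  ultimately have "(\<Union>u'\<in>cls u. \<Union>v'\<in>cls v. cls (u' @ v')) = cls (u @ v)"
    by blast
  then show ?thesis by (simp add: HNN_def)
qed

lemma cls_carrier: "u \<in> hnn_words A \<Longrightarrow> cls u \<in> carrier G"
  by (simp add: HNN_def)

lemma carrierE:
  assumes "x \<in> carrier G" obtains u where "u \<in> hnn_words A" "x = cls u"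
  using assms by (auto simp: HNN_def)

lemma one_cls: "\<one>\<^bsub>G\<^esub> = cls []"
  by (simp add: HNN_def)

lemma word_simps [simp]:
  "[] \<in> hnn_words A"
  "x # u \<in> hnn_words A \<longleftrightarrow> (x \<in> Base ` carrier A \<or> x = Stable \<or> x = Stable_inv) \<and> u \<in> hnn_words A"
  by (auto simp: hnn_words_def)

lemma letter_inverse:
  assumes "[x] \<in> hnn_words A"
  shows "\<exists>y. [y] \<in> hnn_words A \<and> hnn_cong A C \<phi> [y, x] []"
proof (cases x)
  case (Base a)
  then have a: "a \<in> carrier A" using assms by auto
  have "hnn_cong A C \<phi> [Base (inv a), Base a] []"
    using hnn_cong.base_mult[of "inv a" A a C \<phi>] hnn_cong.base_one[of A C \<phi>] a
    by (auto intro: hnn_cong.trans)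
  then show ?thesis using a Base by (intro exI[of _ "Base (inv a)"]) auto
next
  case Stable
  then show ?thesis by (intro exI[of _ Stable_inv]) (auto intro: hnn_cong.left_inv)
next
  case Stable_inv
  then show ?thesis by (intro exI[of _ Stable]) (auto intro: hnn_cong.right_inv)
qed

lemma word_inverse:
  assumes "u \<in> hnn_words A"
  shows "\<exists>v \<in> hnn_words A. hnn_cong A C \<phi> (v @ u) []"
  using assms
proof (induction u)
  case Nil
  then show ?case by (intro bexI[of _ "[]"]) (auto intro: hnn_cong.refl)
next
  case (Cons x u)
  then obtain v where v: "v \<in> hnn_words A" "hnn_cong A C \<phi> (v @ u) []" by auto
  obtain y where y: "[y] \<in> hnn_words A" "hnn_cong A C \<phi> [y, x] []"
    using letter_inverse[of x] Cons.prems by auto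
  have "hnn_cong A C \<phi> (v @ ([y, x] @ u)) (v @ ([] @ u))"
    using y v Cons.prems by (intro hnn_cong.append hnn_cong.refl) auto
  then have "hnn_cong A C \<phi> ((v @ [y]) @ (x # u)) []"
    using v(2) by (auto intro: hnn_cong.trans)
  then show ?case using words_append[OF v(1) y(1)] by blast
qed

lemma group_HNN: "group G"
proof (rule groupI)
  fix x y z assume "x \<in> carrier G" "y \<in> carrier G" "z \<in> carrier G"
  then show "x \<otimes>\<^bsub>G\<^esub> y \<otimes>\<^bsub>G\<^esub> z = x \<otimes>\<^bsub>G\<^esub> (y \<otimes>\<^bsub>G\<^esub> z)"
    by (auto elim!: carrierE simp: cls_mult words_append)
next
  fix x assume "x \<in> carrier G"
  then obtain u where u: "u \<in> hnn_words A" "x = cls u" by (rule carrierE)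
  obtain v where v: "v \<in> hnn_words A" "hnn_cong A C \<phi> (v @ u) []"
    using word_inverse[OF u(1)] by blast
  then have "cls v \<otimes>\<^bsub>G\<^esub> x = \<one>\<^bsub>G\<^esub>"
    using u by (simp add: cls_mult one_cls cls_eq words_append)
  then show "\<exists>y\<in>carrier G. y \<otimes>\<^bsub>G\<^esub> x = \<one>\<^bsub>G\<^esub>"
    using cls_carrier[OF v(1)] by blast
qed (auto elim!: carrierE simp: cls_mult words_append cls_carrier one_cls)

sublocale G: group G by (rule group_HNN)

lemma base_hom: "\<iota> \<in> hom A G"
proof (rule homI)
  fix a b assume ab: "a \<in> carrier A" "b \<in> carrier A"
  then show "\<iota> (a \<otimes> b) = \<iota> a \<otimes>\<^bsub>G\<^esub> \<iota> b"
    using cls_eq[of "[Base a, Base b]" "[Base (a \<otimes> b)]"] hnn_cong.base_mult[OF ab]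
    by (simp add: hnn_base_def cls_mult)
qed (simp add: hnn_base_def cls_carrier)

lemma t_carrier: "t \<in> carrier G"
  by (simp add: hnn_t_def cls_carrier)

lemma inv_t: "inv\<^bsub>G\<^esub> t = cls [Stable_inv]"
  using cls_eq[of "[Stable_inv, Stable]" "[]"] hnn_cong.left_inv[of A C \<phi>]
  by (intro G.inv_equality) (simp_all add: hnn_t_def cls_mult one_cls cls_carrier)

lemma t_conj: "c \<in> C \<Longrightarrow> t \<otimes>\<^bsub>G\<^esub> \<iota> c \<otimes>\<^bsub>G\<^esub> inv\<^bsub>G\<^esub> t = \<iota> (\<phi> c)"
  using cls_eq[of "[Stable, Base c, Stable_inv]" "[Base (\<phi> c)]"]
    hnn_cong.stable_conj[of c C A \<phi>] C_mem[of c]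
  by (simp add: inv_t) (simp add: hnn_t_def hnn_base_def cls_mult)

text \<open>The universal property of the presentation.\<close>

fun word_eval :: "('b, 'n) monoid_scheme \<Rightarrow> ('a \<Rightarrow> 'b) \<Rightarrow> 'b \<Rightarrow> 'a letter list \<Rightarrow> 'b" where
  "word_eval H f s [] = \<one>\<^bsub>H\<^esub>"
| "word_eval H f s (Base a # u) = f a \<otimes>\<^bsub>H\<^esub> word_eval H f s u"
| "word_eval H f s (Stable # u) = s \<otimes>\<^bsub>H\<^esub> word_eval H f s u"
| "word_eval H f s (Stable_inv # u) = inv\<^bsub>H\<^esub> s \<otimes>\<^bsub>H\<^esub> word_eval H f s u"

theorem HNN_universal:
  fixes H :: "('b, 'n) monoid_scheme"
  assumes H: "group H" and f: "f \<in> hom A H" and s: "s \<in> carrier H"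
    and rel: "\<And>c. c \<in> C \<Longrightarrow> s \<otimes>\<^bsub>H\<^esub> f c \<otimes>\<^bsub>H\<^esub> inv\<^bsub>H\<^esub> s = f (\<phi> c)"
  shows "\<exists>F \<in> hom G H. (\<forall>a \<in> carrier A. F (\<iota> a) = f a) \<and> F t = s"
proof -
  interpret H: group H by (rule H)
  interpret f: group_hom A H f by unfold_locales (rule f)
  let ?e = "word_eval H f s"
  have e_closed: "?e u \<in> carrier H" if "u \<in> hnn_words A" for u
    using that s by (induction u) auto
  have e_append: "?e (u @ v) = ?e u \<otimes>\<^bsub>H\<^esub> ?e v" if "u \<in> hnn_words A" "v \<in> hnn_words A" for u v
    using that s by (induction u) (auto simp: e_closed H.m_assoc)
  have e_cong: "?e u = ?e v" if "hnn_cong A C \<phi> u v" for u v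
    using that
  proof (induction rule: hnn_cong.induct)
    case (append u u' v v')
    then show ?case using e_append cong_words by metis
  next
    case (stable_conj c)
    then show ?case
      using rel[of c] s C_mem[of c] C'_mem[OF \<phi>_mem, of c] by (simp add: H.m_assoc)
  qed (use s in auto)
  define F where "F U = ?e (SOME u. u \<in> U)" for U
  have F_cls: "F (cls u) = ?e u" if "u \<in> hnn_words A" for u
  proof -
    have "u \<in> cls u" using that by (auto simp: hnn_class_def intro: hnn_cong.refl)
    then have "(SOME v. v \<in> cls u) \<in> cls u" by (rule someI)
    then show ?thesis using e_cong unfolding F_def hnn_class_def by auto
  qed
  have "F \<in> hom G H"
    by (rule homI) (auto elim!: carrierE simp: F_cls cls_mult e_append e_closed words_append)
  moreover have "F (\<iota> a) = f a" if "a \<in> carrier A" for a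
    using that by (simp add: hnn_base_def F_cls)
  moreover have "F t = s" using s by (simp add: hnn_t_def F_cls)
  ultimately show ?thesis by blast
qed

lemma hnn_core_greatest:
  "hnn_core A C C' \<phi> \<lhd> G" "hnn_core A C C' \<phi> \<subseteq> \<iota> ` (C \<inter> C')"
  "\<And>N. N \<lhd> G \<Longrightarrow> N \<subseteq> \<iota> ` (C \<inter> C') \<Longrightarrow> N \<subseteq> hnn_core A C C' \<phi>"
proof -
  interpret \<iota>: group_hom A G \<iota> by unfold_locales (rule base_hom)
  let ?K = "\<iota> ` (C \<inter> C')"
  let ?P = "\<lambda>N. N \<lhd> G \<and> N \<subseteq> ?K"
  have K: "subgroup ?K G"
    using \<iota>.subgroup_img_is_subgroup A.subgroups_Inter_pair C_subgroup C'_subgroup by blast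
  let ?U = "\<Union> {N. ?P N}"
  let ?M = "generate G ?U"
  have UK: "?U \<subseteq> ?K" by blast
  then have UG: "?U \<subseteq> carrier G" using subgroup.subset[OF K] by blast
  have "?M \<lhd> G"
    by (rule G.normal_generateI[OF UG]) (auto dest: G.normal_invE(2))
  moreover have "?M \<subseteq> ?K"
    using G.generate_subgroup_incl[OF UK K] .
  ultimately have PM: "?P ?M" by simp
  have ub: "N \<subseteq> ?M" if "?P N" for N
    using that by (auto intro: generate.incl)
  have "?P (hnn_core A C C' \<phi>)" and "hnn_core A C C' \<phi> = ?M"
    using GreatestI2_order[of ?P ?M ?P] Greatest_equality[of ?P ?M] PM ub
    unfolding hnn_core_def by auto
  then show "hnn_core A C C' \<phi> \<lhd> G" "hnn_core A C C' \<phi> \<subseteq> ?K"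
    "\<And>N. N \<lhd> G \<Longrightarrow> N \<subseteq> ?K \<Longrightarrow> N \<subseteq> hnn_core A C C' \<phi>"
    using ub by auto
qed

lemma base_normal:
  assumes "hnn_degenerate A C C'"
  shows "\<iota> ` carrier A \<lhd> G"
proof -
  interpret \<iota>: group_hom A G \<iota> by unfold_locales (rule base_hom)
  let ?B = "\<iota> ` carrier A"
  have deg: "C = carrier A" "C' = carrier A" using assms by (auto simp: hnn_degenerate_def)
  have B: "subgroup ?B G" by (rule \<iota>.img_is_subgroup)
  have surj: "\<exists>a\<in>carrier A. \<phi> a = b" if "b \<in> carrier A" for b
  proof -
    have "\<phi> ` carrier A = carrier A"
      using \<phi>_iso by (simp add: deg iso_def bij_betw_def)
    then show ?thesis using that by (metis imageE)
  qed
  have t1: "t \<otimes>\<^bsub>G\<^esub> x \<otimes>\<^bsub>G\<^esub> inv\<^bsub>G\<^esub> t \<in> ?B" if "x \<in> ?B" for x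
    using that t_conj \<phi>_mem deg by auto
  have t2: "inv\<^bsub>G\<^esub> t \<otimes>\<^bsub>G\<^esub> x \<otimes>\<^bsub>G\<^esub> t \<in> ?B" if x: "x \<in> ?B" for x
  proof -
    obtain b where b: "b \<in> carrier A" "x = \<iota> b" using x by auto
    obtain a where a: "a \<in> carrier A" "\<phi> a = b" using surj[OF b(1)] by auto
    have "x = t \<otimes>\<^bsub>G\<^esub> \<iota> a \<otimes>\<^bsub>G\<^esub> inv\<^bsub>G\<^esub> t" using t_conj[of a] a b deg by simp
    then have "inv\<^bsub>G\<^esub> t \<otimes>\<^bsub>G\<^esub> x \<otimes>\<^bsub>G\<^esub> t = \<iota> a"
      using a t_carrier by (simp add: G.m_assoc G.inv_cancel_left)
    then show ?thesis using a by simp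
  qed
  have step: "cls [l] \<otimes>\<^bsub>G\<^esub> x \<otimes>\<^bsub>G\<^esub> inv\<^bsub>G\<^esub> (cls [l]) \<in> ?B" if "[l] \<in> hnn_words A" "x \<in> ?B" for l x
  proof (cases l)
    case (Base a)
    then have "cls [l] \<in> ?B" using that by (auto simp: hnn_base_def)
    then show ?thesis
      by (intro subgroup.m_closed[OF B] subgroup.m_inv_closed[OF B] that(2))
  next
    case Stable
    then show ?thesis using t1[OF that(2)] by (simp add: hnn_t_def)
  next
    case Stable_inv
    then have "cls [l] = inv\<^bsub>G\<^esub> t" by (simp add: inv_t)
    then show ?thesis using t2[OF that(2)] G.inv_inv[OF t_carrier] by (simp only:)
  qed
  show ?thesis
  proof (rule G.normal_invI[OF B])
    fix g x assume g: "g \<in> carrier G" and x: "x \<in> ?B"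
    obtain u where u: "u \<in> hnn_words A" "g = cls u" using g by (rule carrierE)
    have "cls u \<otimes>\<^bsub>G\<^esub> x \<otimes>\<^bsub>G\<^esub> inv\<^bsub>G\<^esub> (cls u) \<in> ?B" using u(1) x
    proof (induction u arbitrary: x)
      case Nil
      then show ?case using subgroup.mem_carrier[OF B Nil(2)] by (simp flip: one_cls)
    next
      case (Cons l u)
      have w: "[l] \<in> hnn_words A" "u \<in> hnn_words A" using Cons.prems by auto
      have xG: "x \<in> carrier G" using Cons.prems subgroup.mem_carrier[OF B] by blast
      have lu: "cls (l # u) = cls [l] \<otimes>\<^bsub>G\<^esub> cls u" using cls_mult[OF w] by simp
      have "cls (l # u) \<otimes>\<^bsub>G\<^esub> x \<otimes>\<^bsub>G\<^esub> inv\<^bsub>G\<^esub> (cls (l # u)) =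
          cls [l] \<otimes>\<^bsub>G\<^esub> (cls u \<otimes>\<^bsub>G\<^esub> x \<otimes>\<^bsub>G\<^esub> inv\<^bsub>G\<^esub> (cls u)) \<otimes>\<^bsub>G\<^esub> inv\<^bsub>G\<^esub> (cls [l])"
        using w[THEN cls_carrier] xG by (simp add: lu G.m_assoc G.inv_mult_group)
      then show ?case using step[OF w(1) Cons.IH[OF w(2) Cons.prems(2)]] by simp
    qed
    then show "g \<otimes>\<^bsub>G\<^esub> x \<otimes>\<^bsub>G\<^esub> inv\<^bsub>G\<^esub> g \<in> ?B" using u by simp
  qed
qed

lemma hnn_Theta_hom:
  assumes "hnn_degenerate A C C'"
  shows "hnn_Theta A C \<phi> \<in> hom integer_group (Out (hnn_base_group A C \<phi>))"
proof -
  have "(\<lambda>k::int. t [^]\<^bsub>G\<^esub> k) \<in> hom integer_group G"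
    using t_carrier by (auto intro!: homI simp: G.int_pow_mult)
  from Group.hom_compose[OF this G.outer_action_hom[OF base_normal[OF assms]]]
  show ?thesis by (simp add: hnn_Theta_def[abs_def] hnn_base_group_def comp_def)
qed

lemma hnn_Theta_1:
  "hnn_Theta A C \<phi> 1 = outer_action G (\<iota> ` carrier A) t"
  using t_carrier by (simp add: hnn_Theta_def)

end

end

(* Words act on the normal forms of vertices of the Bass-Serre tree, whence the t-length of a
   reduced word is determined by the element it represents. If x = a_0 t^e_1 a_1 ... t^e_n a_n is
   reduced and the extension is non-degenerate, then, unless x lies in the intersection of C and
   C', some conjugate b x b^-1 with b in A can be conjugated by all powers of t, or of t^-1,
   without cancellation, so x has infinitely many conjugates. Hence the normal subgroup of
   FC-elements of G is contained in the largest normal subgroup of G inside that intersection.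

   In the degenerate case G is an extension of the integers by A. If x = b t^n is an FC-element,
   its commutators with A are FC-elements of A, hence trivial, and t^n acts on A as b^-1 does.
   Conversely, if t^n acts on A as conjugation by b, then b^-1 t^n commutes with A and with t^n,
   so it has at most |n| conjugates. *)

theory Submission
  imports Defs
begin

section \<open>FC-elements and outer actions in arbitrary groups\<close>

section \<open>Conjugacy classes and FC-elements\<close>

context group
begin

lemma conj_class_conj:
  assumes "g \<in> carrier G" "x \<in> carrier G"
  shows "conj_class G (g \<otimes> x \<otimes> inv g) = conj_class G x"
proof -
  have sub: "conj_class G (g \<otimes> x \<otimes> inv g) \<subseteq> conj_class G x"
    if "g \<in> carrier G" "x \<in> carrier G" for g x
  proof
    fix y assume "y \<in> conj_class G (g \<otimes> x \<otimes> inv g)"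
    then obtain h where h: "h \<in> carrier G" "y = h \<otimes> (g \<otimes> x \<otimes> inv g) \<otimes> inv h"
      by (auto simp: conj_class_def)
    then have "y = (h \<otimes> g) \<otimes> x \<otimes> inv (h \<otimes> g)"
      using that by (simp add: m_assoc inv_mult_group)
    then show "y \<in> conj_class G x" using h that by (auto simp: conj_class_def)
  qed
  \<comment> \<open>Conjugating back by \<open>inv g\<close> makes the same inclusion yield the
    reverse one.\<close>
  have "inv g \<otimes> (g \<otimes> x \<otimes> inv g) \<otimes> inv (inv g) = x"
    using assms by (simp add: m_assoc inv_cancel_left)
  with sub[of "inv g" "g \<otimes> x \<otimes> inv g"] sub[OF assms] assms show ?thesis by auto
qed

lemma conj_class_one: "conj_class G \<one> = {\<one>}"
  by (auto simp: conj_class_def intro!: exI[of _ \<one>])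

lemma conj_class_closed:
  assumes "g \<in> carrier G" "x \<in> carrier G" "y \<in> conj_class G x"
  shows "g \<otimes> y \<otimes> inv g \<in> conj_class G x"
proof -
  obtain h where h: "h \<in> carrier G" "y = h \<otimes> x \<otimes> inv h"
    using assms(3) by (auto simp: conj_class_def)
  then have "g \<otimes> y \<otimes> inv g = (g \<otimes> h) \<otimes> x \<otimes> inv (g \<otimes> h)"
    using assms by (simp add: m_assoc inv_mult_group)
  then show ?thesis using assms h by (auto simp: conj_class_def)
qed

lemma commutes_inv:
  assumes "x \<otimes> y = y \<otimes> x" "x \<in> carrier G" "y \<in> carrier G"
  shows "inv x \<otimes> y = y \<otimes> inv x"
proof -
  have "inv x \<otimes> y = inv x \<otimes> (y \<otimes> x) \<otimes> inv x" using assms by (simp add: m_assoc)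
  also have "\<dots> = y \<otimes> inv x" using assms by (simp add: m_assoc inv_cancel_left flip: assms(1))
  finally show ?thesis .
qed

lemma commutes_int_pow:
  assumes "x \<otimes> y = y \<otimes> x" "x \<in> carrier G" "y \<in> carrier G"
  shows "x [^] (n::int) \<otimes> y = y \<otimes> x [^] n"
proof (cases "n < 0")
  case True
  then show ?thesis
    using commutes_inv[OF group_commutes_pow[OF assms] nat_pow_closed[OF assms(2)] assms(3)]
    unfolding int_pow_def2 by (simp only: if_True)
next
  case False
  then show ?thesis
    using group_commutes_pow[OF assms] unfolding int_pow_def2 by (simp only: if_False)
qed

text \<open>A coset modulo \<open>Inn\<close> is trivial exactly when its representative is itself
  inner. Inverses in \<open>N\<close> agree with those of \<open>G\<close>, so being inner can be
  tested in \<open>G\<close>.\<close>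

lemma outer_action_eq_one_iff:
  assumes N: "N \<lhd> G" and g: "g \<in> carrier G"
  shows "outer_action G N g = \<one>\<^bsub>Out (G\<lparr>carrier := N\<rparr>)\<^esub> \<longleftrightarrow>
    (\<exists>a\<in>N. \<forall>x\<in>N. g \<otimes> x \<otimes> inv g = a \<otimes> x \<otimes> inv a)"
proof -
  let ?N = "G\<lparr>carrier := N\<rparr>"
  have sub: "subgroup N G" by (rule normal_imp_subgroup[OF N])
  interpret N: group ?N by (rule subgroup_imp_group[OF sub])
  interpret AG: group "AutoGroup ?N" by (rule N.AutoGroup)
  have Inn: "subgroup (Inn ?N) (AutoGroup ?N)" by (rule normal_imp_subgroup[OF N.Inn_normal])
  have cm: "conj_map G N g \<in> carrier (AutoGroup ?N)"
    using conj_map_auto[OF N g] by (simp add: AutoGroup_def)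
  have "outer_action G N g = \<one>\<^bsub>Out ?N\<^esub> \<longleftrightarrow> conj_map G N g \<in> Inn ?N"
    using AG.coset_join1[OF _ cm Inn] AG.coset_join2[OF cm Inn]
    by (auto simp: outer_action_def Out_def FactGroup_def)
  also have "\<dots> \<longleftrightarrow> (\<exists>a\<in>N. conj_map G N g = conj_map ?N N a)"
    by (auto simp: Inn_def)
  also have "\<dots> \<longleftrightarrow> (\<exists>a\<in>N. \<forall>x\<in>N. g \<otimes> x \<otimes> inv g = a \<otimes> x \<otimes> inv a)"
    using sub by (intro bex_cong) (auto simp: conj_map_def restrict_def fun_eq_iff)
  finally show ?thesis .
qed

text \<open>The class of an inverse consists of inverses of conjugates, and the class of a product
  lies in the product of the two classes. Normality is what allows the maximality of
  \<open>hnn_core\<close> to be applied, and it puts commutators with FC-elements back into this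
  subgroup.\<close>

lemma FC_normal: "FC G (carrier G) \<lhd> G"
proof (rule normal_invI)
  show "subgroup (FC G (carrier G)) G"
  proof (rule subgroupI)
    show "FC G (carrier G) \<subseteq> carrier G" by (auto simp: FC_def)
    show "FC G (carrier G) \<noteq> {}" using conj_class_one by (auto simp: FC_def intro!: exI[of _ \<one>])
  next
    fix x assume x: "x \<in> FC G (carrier G)"
    have "conj_class G (inv x) \<subseteq> (\<lambda>y. inv y) ` conj_class G x"
    proof
      fix y assume "y \<in> conj_class G (inv x)"
      then obtain g where g: "g \<in> carrier G" "y = g \<otimes> inv x \<otimes> inv g"
        by (auto simp: conj_class_def)
      then have "y = inv (g \<otimes> x \<otimes> inv g)"
        using x by (simp add: FC_def m_assoc inv_mult_group)
      then show "y \<in> (\<lambda>y. inv y) ` conj_class G x" using g by (auto simp: conj_class_def)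
    qed
    then show "inv x \<in> FC G (carrier G)" using x finite_subset by (auto simp: FC_def)
  next
    fix x y assume xy: "x \<in> FC G (carrier G)" "y \<in> FC G (carrier G)"
    have "conj_class G (x \<otimes> y) \<subseteq> (\<lambda>(u, v). u \<otimes> v) ` (conj_class G x \<times> conj_class G y)"
    proof
      fix z assume "z \<in> conj_class G (x \<otimes> y)"
      then obtain g where g: "g \<in> carrier G" "z = g \<otimes> (x \<otimes> y) \<otimes> inv g"
        by (auto simp: conj_class_def)
      then have "z = (g \<otimes> x \<otimes> inv g) \<otimes> (g \<otimes> y \<otimes> inv g)"
        using xy by (simp add: FC_def m_assoc inv_cancel_left)
      then show "z \<in> (\<lambda>(u, v). u \<otimes> v) ` (conj_class G x \<times> conj_class G y)"
        using g by (auto simp: conj_class_def)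
    qed
    then show "x \<otimes> y \<in> FC G (carrier G)" using xy finite_subset by (fastforce simp: FC_def)
  qed
next
  fix g x assume "g \<in> carrier G" "x \<in> FC G (carrier G)"
  then show "g \<otimes> x \<otimes> inv g \<in> FC G (carrier G)" by (simp add: FC_def conj_class_conj)
qed

lemma icc_iff_FC: "icc G \<longleftrightarrow> infinite (carrier G) \<and> FC G (carrier G) = {\<one>}"
  using conj_class_one by (auto simp: icc_def FC_def)

end

section \<open>The action of words on reduced sequences\<close>

context hnn_data
begin

section \<open>The associated subgroups and the isomorphisms between them\<close>

definition edge :: "bool \<Rightarrow> 'a set" where
  "edge e = (if e then C' else C)"

text \<open>\<open>True\<close> and \<open>False\<close> encode the exponents \<open>1\<close> and \<open>-1\<close> of \<open>t\<close>. Moving \<open>c \<in> edge e\<close> past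
  \<open>t\<^sup>e\<close> from left to right turns it into \<open>edge_map e c\<close>.\<close>

definition edge_map :: "bool \<Rightarrow> 'a \<Rightarrow> 'a" where
  "edge_map e = (if e then inv_into C \<phi> else \<phi>)"

lemma edge_subgroup: "subgroup (edge e) A"
  by (simp add: edge_def C_subgroup C'_subgroup)

lemma edge_carrier [simp]: "c \<in> edge e \<Longrightarrow> c \<in> carrier A"
  using subgroup.mem_carrier[OF edge_subgroup] .

lemma edge_one [simp]: "\<one> \<in> edge e"
  using subgroup.one_closed[OF edge_subgroup] .

text \<open>Needed to see that an edge element carried along a sequence neither creates nor destroys
  a cancellation.\<close>

lemma edge_mult_cancel:
  assumes "c \<in> edge e" "g \<in> carrier A"
  shows "c \<otimes> g \<in> edge e \<longleftrightarrow> g \<in> edge e" "g \<otimes> c \<in> edge e \<longleftrightarrow> g \<in> edge e"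
proof -
  note cl = subgroup.m_closed[OF edge_subgroup] subgroup.m_inv_closed[OF edge_subgroup]
  have eq: "inv c \<otimes> (c \<otimes> g) = g" "(g \<otimes> c) \<otimes> inv c = g"
    using assms by (simp_all add: A.inv_cancel_left A.m_assoc)
  show "c \<otimes> g \<in> edge e \<longleftrightarrow> g \<in> edge e"
    using cl(1)[OF cl(2)[OF assms(1)], of "c \<otimes> g"] cl(1)[OF assms(1), of g] unfolding eq by blast
  show "g \<otimes> c \<in> edge e \<longleftrightarrow> g \<in> edge e"
    using cl(1)[OF _ cl(2)[OF assms(1)], of "g \<otimes> c"] cl(1)[OF _ assms(1), of g] unfolding eq by blast
qed

lemma \<phi>_bij: "bij_betw \<phi> C C'"
  using \<phi>_iso by (simp add: iso_def)

lemma edge_map_mem: "c \<in> edge e \<Longrightarrow> edge_map e c \<in> edge (\<not> e)"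
  using \<phi>_bij \<phi>_mem inv_into_into[of c \<phi> C] by (auto simp: edge_def edge_map_def bij_betw_def)

lemma edge_map_inverse: "c \<in> edge e \<Longrightarrow> edge_map (\<not> e) (edge_map e c) = c"
  using \<phi>_bij by (auto simp: edge_def edge_map_def bij_betw_def f_inv_into_f)

lemma edge_map_mult:
  assumes "c \<in> edge e" "d \<in> edge e"
  shows "edge_map e (c \<otimes> d) = edge_map e c \<otimes> edge_map e d"
proof -
  have mult: "\<phi> (a \<otimes> b) = \<phi> a \<otimes> \<phi> b" if "a \<in> C" "b \<in> C" for a b
    using \<phi>_iso that by (auto simp: iso_def hom_def)
  show ?thesis
  proof (cases e)
    case True
    have ab: "edge_map e c \<in> C" "edge_map e d \<in> C"
      using edge_map_mem[OF assms(1)] edge_map_mem[OF assms(2)] True by (simp_all add: edge_def)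
    have "\<phi> (edge_map e c \<otimes> edge_map e d) = c \<otimes> d"
      using mult[OF ab] edge_map_inverse[OF assms(1)] edge_map_inverse[OF assms(2)] True
      by (simp add: edge_map_def)
    then have "edge_map e (c \<otimes> d) = inv_into C \<phi> (\<phi> (edge_map e c \<otimes> edge_map e d))"
      using True by (simp add: edge_map_def)
    also have "\<dots> = edge_map e c \<otimes> edge_map e d"
      using \<phi>_bij subgroup.m_closed[OF C_subgroup ab] by (simp add: bij_betw_def)
    finally show ?thesis .
  next
    case False
    then show ?thesis using assms mult by (simp add: edge_def edge_map_def)
  qed
qed

lemma edge_map_one [simp]: "edge_map e \<one> = \<one>"
proof -
  have "edge_map e \<one> \<otimes> edge_map e \<one> = edge_map e \<one>"
    using edge_map_mult[of \<one> e \<one>] by simp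
  moreover have "edge_map e \<one> \<in> carrier A"
    using edge_map_mem[of \<one> e] by simp
  ultimately show ?thesis by simp
qed

text \<open>A representative of the left coset of \<open>a\<close> modulo \<open>edge e\<close>. The
  subgroup itself is represented by \<open>\<one>\<close>, so that a cancellation can be read off
  from a coefficient being \<open>\<one>\<close>.\<close>

definition rep :: "bool \<Rightarrow> 'a \<Rightarrow> 'a" where
  "rep e a = (if a \<in> edge e then \<one> else SOME g. g \<in> carrier A \<and> inv a \<otimes> g \<in> edge e)"

lemma rep_props:
  assumes "a \<in> carrier A"
  shows rep_closed: "rep e a \<in> carrier A" and rep_mem': "inv a \<otimes> rep e a \<in> edge e"
proof -
  have "\<exists>g. g \<in> carrier A \<and> inv a \<otimes> g \<in> edge e" using assms by (intro exI[of _ a]) simp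
  from someI_ex[OF this] show "rep e a \<in> carrier A" "inv a \<otimes> rep e a \<in> edge e"
    using assms subgroup.m_inv_closed[OF edge_subgroup] by (auto simp: rep_def)
qed

lemma rep_mem:
  assumes "a \<in> carrier A"
  shows "inv (rep e a) \<otimes> a \<in> edge e"
  using subgroup.m_inv_closed[OF edge_subgroup rep_mem'[OF assms, of e]] rep_closed[OF assms] assms
  by (simp add: A.inv_mult_group)

text \<open>For two elements of one coset the predicates under \<open>SOME\<close> are equal as
  functions, hence so are the chosen elements.\<close>

lemma rep_cong:
  assumes "a \<in> carrier A" "b \<in> carrier A" "inv a \<otimes> b \<in> edge e"
  shows "rep e a = rep e b"
proof -
  have ab: "a \<otimes> (inv a \<otimes> b) = b" using assms by (simp add: A.inv_cancel_left)
  have "a \<in> edge e \<longleftrightarrow> b \<in> edge e"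
    using edge_mult_cancel(2)[OF assms(3) assms(1)] ab by simp
  moreover have "inv a \<otimes> g \<in> edge e \<longleftrightarrow> inv b \<otimes> g \<in> edge e" if "g \<in> carrier A" for g
  proof -
    have "inv a \<otimes> g = (inv a \<otimes> b) \<otimes> (inv b \<otimes> g)"
      using assms that by (simp add: A.m_assoc A.inv_cancel_left)
    then show ?thesis using edge_mult_cancel(1)[OF assms(3), of "inv b \<otimes> g"] assms that by simp
  qed
  then have "(\<lambda>g. g \<in> carrier A \<and> inv a \<otimes> g \<in> edge e) =
      (\<lambda>g. g \<in> carrier A \<and> inv b \<otimes> g \<in> edge e)" by blast
  ultimately show ?thesis by (simp add: rep_def)
qed

lemma rep_mult: "a \<in> carrier A \<Longrightarrow> b \<in> carrier A \<Longrightarrow> rep e (a \<otimes> rep e b) = rep e (a \<otimes> b)"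
  using rep_closed[of b e] rep_mem[of b e]
  by (intro rep_cong) (simp_all add: A.inv_mult_group A.m_assoc A.inv_cancel_left)

lemma rep_rep: "a \<in> carrier A \<Longrightarrow> rep e (rep e a) = rep e a"
  using rep_mult[of \<one> a e] rep_closed[of a e] by simp

text \<open>For \<open>a\<close> outside the subgroup, a representative \<open>\<one>\<close> would
  put \<open>a\<close> into it by \<open>rep_mem\<close>. This reconciles \<open>push\<close>, which
  tests for the coefficient \<open>\<one>\<close>, with \<open>reduced\<close>, which tests
  membership in \<open>edge\<close>.\<close>

lemma rep_eq_one_iff: "a \<in> carrier A \<Longrightarrow> rep e a = \<one> \<longleftrightarrow> a \<in> edge e"
  using rep_mem[of a e] by (auto simp: rep_def)

lemma rep_edge [simp]: "a \<in> edge e \<Longrightarrow> rep e a = \<one>"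
  by (simp add: rep_def)

section \<open>Normal forms for vertices of the tree and the action of letters on them\<close>

text \<open>A sequence \<open>(g\<^sub>1, e\<^sub>1), \<dots>, (g\<^sub>n, e\<^sub>n)\<close> stands for \<open>g\<^sub>1 t^e\<^sub>1 \<dots> g\<^sub>n t^e\<^sub>n\<close>, and a normal one
  for a vertex of the Bass-Serre tree, that is, a left coset of \<open>A\<close> in \<open>G\<close>.\<close>

definition reduced :: "('a \<times> bool) list \<Rightarrow> bool" where
  "reduced w \<longleftrightarrow> fst ` set w \<subseteq> carrier A \<and>
     successively (\<lambda>(g, e) (h, d). d \<noteq> e \<longrightarrow> h \<notin> edge d) w"

definition normal_seq :: "('a \<times> bool) list \<Rightarrow> bool" where
  "normal_seq w \<longleftrightarrow> reduced w \<and> (\<forall>(g, e) \<in> set w. rep e g = g)"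

lemma reduced_Nil [simp]: "reduced []"
  by (simp add: reduced_def)

lemma reduced_Cons:
  "reduced ((g, e) # w) \<longleftrightarrow> g \<in> carrier A \<and> reduced w \<and>
     (\<forall>h d w'. w = (h, d) # w' \<longrightarrow> d \<noteq> e \<longrightarrow> h \<notin> edge d)"
  by (cases w) (auto simp: reduced_def)

lemma normal_seq_Nil [simp]: "normal_seq []"
  by (simp add: normal_seq_def)

lemma normal_seq_Cons:
  "normal_seq ((g, e) # w) \<longleftrightarrow> g \<in> carrier A \<and> rep e g = g \<and> normal_seq w \<and>
     (\<forall>h d w'. w = (h, d) # w' \<longrightarrow> d \<noteq> e \<longrightarrow> h \<notin> edge d)"
  by (auto simp: normal_seq_def reduced_Cons)

text \<open>Left multiplication by \<open>a\<close> on cosets of \<open>A\<close>: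
  \<open>a \<otimes> g\<close> is its representative times an element of \<open>edge e\<close>,
  which is moved past the stable letter and multiplies the next coefficient. What arrives at the end
  is absorbed by \<open>A\<close>.\<close>

fun act :: "'a \<Rightarrow> ('a \<times> bool) list \<Rightarrow> ('a \<times> bool) list" where
  "act a [] = []"
| "act a ((g, e) # w) =
     (rep e (a \<otimes> g), e) # act (edge_map e (inv (rep e (a \<otimes> g)) \<otimes> (a \<otimes> g))) w"

text \<open>Left multiplication by the stable letter with exponent \<open>e\<close>; it cancels only
  against an inverse letter in front whose coefficient is \<open>\<one>\<close>.\<close>

fun push :: "bool \<Rightarrow> ('a \<times> bool) list \<Rightarrow> ('a \<times> bool) list" where
  "push e [] = [(\<one>, e)]"
| "push e ((g, d) # w) = (if g = \<one> \<and> d \<noteq> e then w else (\<one>, e) # (g, d) # w)"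

lemma length_act [simp]: "length (act a w) = length w"
  by (induction a w rule: act.induct) auto

lemma act_one: "normal_seq w \<Longrightarrow> act \<one> w = w"
  by (induction w) (auto simp: normal_seq_Cons)

lemma edge_remainder:
  "a \<in> carrier A \<Longrightarrow> edge_map e (inv (rep e a) \<otimes> a) \<in> edge (\<not> e)"
  by (rule edge_map_mem[OF rep_mem])

lemma act_mult:
  assumes "a \<in> carrier A" "b \<in> carrier A" "fst ` set w \<subseteq> carrier A"
  shows "act a (act b w) = act (a \<otimes> b) w"
  using assms
proof (induction w arbitrary: a b)
  case (Cons x w)
  obtain g e where x: "x = (g, e)" by force
  have g: "g \<in> carrier A" and w: "fst ` set w \<subseteq> carrier A" using Cons.prems x by auto
  define h where "h = b \<otimes> g"
  define k where "k = a \<otimes> h"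
  have hk: "h \<in> carrier A" "k \<in> carrier A" using Cons.prems g by (auto simp: h_def k_def)
  note rc = rep_closed[OF hk(1), of e] rep_closed[OF hk(2), of e]
  have k: "a \<otimes> b \<otimes> g = k" using Cons.prems g by (simp add: h_def k_def A.m_assoc)
  have r: "rep e (a \<otimes> rep e h) = rep e k"
    using rep_mult[OF Cons.prems(1) hk(1)] by (simp add: k_def)
  \<comment> \<open>The remainders of the two successive actions multiply to the remainder of the
    combined one, so the elements carried further agree as well.\<close>
  have s: "(inv (rep e k) \<otimes> (a \<otimes> rep e h)) \<otimes> (inv (rep e h) \<otimes> h) = inv (rep e k) \<otimes> k"
    using Cons.prems(1) hk rc by (simp add: k_def A.m_assoc A.inv_cancel_left)
  have ar: "a \<otimes> rep e h \<in> carrier A" using Cons.prems(1) rc by simp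
  have m: "inv (rep e k) \<otimes> (a \<otimes> rep e h) \<in> edge e"
    using rep_mem[OF ar, of e] r by simp
  have em: "edge_map e (inv (rep e k) \<otimes> (a \<otimes> rep e h)) \<otimes> edge_map e (inv (rep e h) \<otimes> h)
      = edge_map e (inv (rep e k) \<otimes> k)"
    using edge_map_mult[OF m rep_mem[OF hk(1), of e]] s by simp
  have "edge_map e (inv (rep e k) \<otimes> (a \<otimes> rep e h)) \<in> carrier A"
    "edge_map e (inv (rep e h) \<otimes> h) \<in> carrier A"
    using edge_map_mem[OF m] edge_remainder[OF hk(1), of e] edge_carrier by blast+
  from Cons.IH[OF this w] show ?case
    by (simp add: x r k em flip: h_def)
qed simp

lemma normal_seq_act: "a \<in> carrier A \<Longrightarrow> normal_seq w \<Longrightarrow> normal_seq (act a w)"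
proof (induction w arbitrary: a)
  case (Cons x w)
  obtain g e where x: "x = (g, e)" by force
  have ag: "a \<otimes> g \<in> carrier A" using Cons.prems x by (simp add: normal_seq_Cons)
  let ?c = "edge_map e (inv (rep e (a \<otimes> g)) \<otimes> (a \<otimes> g))"
  have c: "?c \<in> edge (\<not> e)" by (rule edge_remainder[OF ag])
  \<comment> \<open>At a change of sign \<open>edge d\<close> is \<open>edge (\<not> e)\<close>,
    which contains the carried \<open>?c\<close>; multiplying by it keeps the next coefficient
    outside.\<close>
  have "h' \<notin> edge d" if act: "act ?c w = (h', d) # w'" and d: "d \<noteq> e" for h' d w'
  proof -
    obtain h v where w: "w = (h, d) # v" and h': "h' = rep d (?c \<otimes> h)"
      using act by (cases w) auto
    have h: "h \<in> carrier A" "h \<notin> edge d"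
      using Cons.prems d unfolding x w by (auto simp: normal_seq_Cons)
    have d': "d = (\<not> e)" using d by auto
    have ch: "?c \<otimes> h \<in> carrier A" "?c \<otimes> h \<notin> edge d"
      using edge_mult_cancel(1)[OF c h(1)] h c unfolding d' by auto
    have "rep d h' = h'" using rep_rep[OF ch(1)] h' by simp
    then show ?thesis
      using rep_eq_one_iff[OF ch(1), of d] rep_eq_one_iff[OF rep_closed[OF ch(1)], of d d] h' ch(2)
      by auto
  qed
  moreover have "normal_seq (act ?c w)"
    using Cons.IH[OF edge_carrier[OF c]] Cons.prems(2) by (simp add: x normal_seq_Cons)
  ultimately show ?case
    unfolding x act.simps normal_seq_Cons using rep_closed[OF ag] rep_rep[OF ag] by blast
qed simp

lemma normal_seq_push: "normal_seq w \<Longrightarrow> normal_seq (push e w)"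
  by (cases w) (auto simp: normal_seq_Cons rep_eq_one_iff)

text \<open>If the first push cancels, reducedness of \<open>w\<close> keeps the rest from beginning
  with coefficient \<open>\<one>\<close> and exponent \<open>e\<close>, so the second push restores
  the deleted letter.\<close>

lemma push_push: "normal_seq w \<Longrightarrow> push (\<not> e) (push e w) = w"
proof (cases w)
  case (Cons x v)
  moreover assume "normal_seq w"
  ultimately show ?thesis by (cases x; cases v) (auto simp: normal_seq_Cons)
qed simp

text \<open>The relation moving \<open>c\<close> across the stable letter, transported to normal
  forms. Acting by \<open>c\<close> keeps the first coefficient inside or outside
  \<open>edge (\<not> e)\<close>, so the push cancels on both sides or on neither.\<close>

lemma push_act:
  assumes c: "c \<in> edge (\<not> e)" and w: "normal_seq w"
  shows "push e (act c w) = act (edge_map (\<not> e) c) (push e w)"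
proof -
  obtain d where d: "d \<in> edge e" "edge_map e d = c" "edge_map (\<not> e) c = d"
    using that[of "edge_map (\<not> e) c"] edge_map_mem[OF c] edge_map_inverse[OF c] by simp
  show ?thesis
  proof (cases "\<exists>v. w = (\<one>, \<not> e) # v")
    case True
    then show ?thesis using c by (auto simp: d(3))
  next
    case False
    then have pw: "push e w = (\<one>, e) # w" by (cases "(e, w)" rule: push.cases) auto
    have "push e (act c w) = (\<one>, e) # act c w"
    proof (cases w)
      case (Cons x v)
      obtain g f where x: "x = (g, f)" by force
      have g: "g \<in> carrier A" "rep f g = g" using w Cons x by (auto simp: normal_seq_Cons)
      have "rep f (c \<otimes> g) \<noteq> \<one>" if "f \<noteq> e"
      proof -
        have f: "f = (\<not> e)" using that by auto
        then have "g \<noteq> \<one>" using False Cons x by auto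
        then have "g \<notin> edge f" using g rep_eq_one_iff by auto
        then show ?thesis
          using edge_mult_cancel(1)[OF c g(1)] rep_eq_one_iff[of "c \<otimes> g" f] g c f by auto
      qed
      then show ?thesis by (cases e; cases f) (auto simp: Cons x)
    qed simp
    then show ?thesis using d(1) by (simp add: pw d(2,3))
  qed
qed

fun word_act :: "'a letter list \<Rightarrow> ('a \<times> bool) list \<Rightarrow> ('a \<times> bool) list" where
  "word_act [] w = w"
| "word_act (Base a # u) w = act a (word_act u w)"
| "word_act (Stable # u) w = push True (word_act u w)"
| "word_act (Stable_inv # u) w = push False (word_act u w)"

lemma word_act_append: "word_act (u @ v) w = word_act u (word_act v w)"
  by (induction u w rule: word_act.induct) auto

lemma normal_seq_word_act: "u \<in> hnn_words A \<Longrightarrow> normal_seq w \<Longrightarrow> normal_seq (word_act u w)"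
  by (induction u w rule: word_act.induct) (auto simp: normal_seq_act normal_seq_push)

text \<open>Each defining relation holds for the action: products in \<open>A\<close> by
  \<open>act_mult\<close>, cancellation of t by \<open>push_push\<close>, the HNN relation by
  \<open>push_act\<close>. The image of a vertex thus depends only on the element that the word
  represents.\<close>

lemma word_act_cong: "hnn_cong A C \<phi> u v \<Longrightarrow> normal_seq w \<Longrightarrow> word_act u w = word_act v w"
proof (induction arbitrary: w rule: hnn_cong.induct)
  case (append u u' v v')
  then show ?case using cong_words normal_seq_word_act by (simp add: word_act_append)
next
  case (base_mult a b)
  then show ?case by (auto simp: act_mult normal_seq_def reduced_def)
next
  case right_inv
  then show ?case using push_push[of w False] by simp
next
  case left_inv
  then show ?case using push_push[of w True] by simp
next
  case (stable_conj c)
  then show ?case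
    using push_act[of c True "push False w"] push_push[of w False] normal_seq_push[of w False]
    by (simp add: edge_def edge_map_def)
qed (auto simp: act_one)

section \<open>Products of reduced sequences and uniqueness of their length\<close>

section \<open>Reduced forms\<close>

definition stable :: "bool \<Rightarrow> 'a letter list set" where
  "stable e = (if e then t else inv\<^bsub>G\<^esub> t)"

text \<open>No coefficient follows the last stable letter, as for a coset of \<open>A\<close>; a
  general element is \<open>val w\<close> times some \<open>\<iota> a\<close>.\<close>

fun val :: "('a \<times> bool) list \<Rightarrow> 'a letter list set" where
  "val [] = \<one>\<^bsub>G\<^esub>"
| "val ((a, e) # w) = \<iota> a \<otimes>\<^bsub>G\<^esub> (stable e \<otimes>\<^bsub>G\<^esub> val w)"

fun seq_word :: "('a \<times> bool) list \<Rightarrow> 'a letter list" where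
  "seq_word [] = []"
| "seq_word ((a, e) # w) = Base a # (if e then Stable else Stable_inv) # seq_word w"

lemma stable_closed [simp]: "stable e \<in> carrier G"
  using t_carrier by (simp add: stable_def)

lemma inv_stable: "inv\<^bsub>G\<^esub> (stable e) = stable (\<not> e)"
  using t_carrier by (simp add: stable_def)

lemma base_closed [simp]: "a \<in> carrier A \<Longrightarrow> \<iota> a \<in> carrier G"
  using base_hom by (auto simp: hom_def)

sublocale \<iota>: group_hom A G \<iota>
  by unfold_locales (rule base_hom)

lemma seq_word_words: "fst ` set w \<subseteq> carrier A \<Longrightarrow> seq_word w \<in> hnn_words A"
  by (induction w rule: seq_word.induct) auto

lemma val_seq_word: "fst ` set w \<subseteq> carrier A \<Longrightarrow> val w = cls (seq_word w)"
proof (induction w rule: seq_word.induct)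
  case (2 a e w)
  let ?l = "if e then Stable else Stable_inv"
  have "stable e = cls [?l]" using inv_t by (simp add: stable_def) (simp add: hnn_t_def)
  then show ?case
    using 2 seq_word_words[of w] cls_mult[of "[?l]" "seq_word w"]
      cls_mult[of "[Base a]" "?l # seq_word w"]
    by (simp add: hnn_base_def)
qed (simp add: one_cls)

lemma val_closed [simp]: "fst ` set w \<subseteq> carrier A \<Longrightarrow> val w \<in> carrier G"
  by (simp add: val_seq_word seq_word_words cls_carrier)

lemma val_append:
  "fst ` set v \<subseteq> carrier A \<Longrightarrow> fst ` set w \<subseteq> carrier A \<Longrightarrow>
     val (v @ w) = val v \<otimes>\<^bsub>G\<^esub> val w"
  by (induction v rule: val.induct) (auto simp: G.m_assoc)

text \<open>Applied to the base vertex, a reduced word never triggers the cancelling clause of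
  \<open>push\<close>. The second conjunct strengthens the induction: a leading representative is
  \<open>\<one>\<close> only if the leading coefficient lies in \<open>edge\<close>, which
  reducedness forbids at a change of sign.\<close>

lemma reduced_word_act:
  assumes "reduced w"
  shows "length (word_act (seq_word w) []) = length w \<and>
    (\<forall>a e v. w = (a, e) # v \<longrightarrow> (\<exists>v'. word_act (seq_word w) [] = (rep e a, e) # v'))"
  using assms
proof (induction w)
  case (Cons x w)
  obtain a e where x: "x = (a, e)" by force
  define v where "v = word_act (seq_word w) []"
  have a: "a \<in> carrier A" and w: "reduced w" using Cons.prems x by (auto simp: reduced_Cons)
  have "push e v = (\<one>, e) # v"
  proof (cases w)
    case Nil
    then show ?thesis by (simp add: v_def)
  next
    case (Cons y w')
    obtain b d where y: "y = (b, d)" by force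
    obtain v' where v': "v = (rep d b, d) # v'"
      using Cons.IH[OF w] Cons y unfolding v_def by blast
    show ?thesis
      using Cons.prems rep_eq_one_iff[of b d] by (cases d; cases e) (auto simp: v' x Cons y reduced_Cons)
  qed
  then show ?case
    using Cons.IH[OF w] a by (cases e) (auto simp: x simp flip: v_def)
qed simp

lemma reduced_carrier: "reduced w \<Longrightarrow> fst ` set w \<subseteq> carrier A"
  by (simp add: reduced_def)

text \<open>Both sides move the base vertex \<open>[]\<close> to the same vertex. The trailing
  \<open>\<iota> a\<close> and \<open>\<iota> b\<close> fix \<open>[]\<close>, so the length of that
  vertex is the length of either sequence.\<close>

lemma reduced_length_unique:
  assumes "reduced v" "reduced w" "a \<in> carrier A" "b \<in> carrier A"
    and "val v \<otimes>\<^bsub>G\<^esub> \<iota> a = val w \<otimes>\<^bsub>G\<^esub> \<iota> b"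
  shows "length v = length w"
proof -
  note c = assms(1,2)[THEN reduced_carrier]
  have "hnn_cong A C \<phi> (seq_word v @ [Base a]) (seq_word w @ [Base b])"
    using assms c seq_word_words words_append
    by (simp add: val_seq_word hnn_base_def cls_mult flip: cls_eq)
  from word_act_cong[OF this, of "[]"] show ?thesis
    using reduced_word_act[OF assms(1)] reduced_word_act[OF assms(2)]
    by (simp add: word_act_append)
qed

lemma stable_conj_edge:
  assumes "c \<in> edge (\<not> e)"
  shows "stable e \<otimes>\<^bsub>G\<^esub> (\<iota> c \<otimes>\<^bsub>G\<^esub> stable (\<not> e)) = \<iota> (edge_map (\<not> e) c)"
proof (cases e)
  case True
  then show ?thesis
    using t_conj[of c] assms t_carrier C_mem
    by (simp add: edge_def edge_map_def stable_def G.m_assoc)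
next
  case False
  define d where "d = edge_map True c"
  have d: "d \<in> C" "\<phi> d = c"
    using edge_map_mem[OF assms] edge_map_inverse[OF assms] False
    by (auto simp: d_def edge_def edge_map_def)
  have "t \<otimes>\<^bsub>G\<^esub> \<iota> d \<otimes>\<^bsub>G\<^esub> inv\<^bsub>G\<^esub> t = \<iota> c" using t_conj[OF d(1)] d(2) by simp
  moreover have "inv\<^bsub>G\<^esub> t \<otimes>\<^bsub>G\<^esub> (t \<otimes>\<^bsub>G\<^esub> \<iota> d \<otimes>\<^bsub>G\<^esub> inv\<^bsub>G\<^esub> t \<otimes>\<^bsub>G\<^esub> t) = \<iota> d"
    using t_carrier d(1) C_mem by (simp add: G.m_assoc G.inv_cancel_left)
  ultimately have "inv\<^bsub>G\<^esub> t \<otimes>\<^bsub>G\<^esub> (\<iota> c \<otimes>\<^bsub>G\<^esub> t) = \<iota> d" by simp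
  then show ?thesis using False by (simp add: stable_def d_def)
qed

text \<open>The elements with such a form include \<open>\<one>\<close> and are closed under left
  multiplication by letters: an element of \<open>A\<close> merges into the first coefficient, and a
  stable letter either cancels by \<open>stable_conj_edge\<close> or can be prepended.\<close>

lemma reduced_form:
  assumes "x \<in> carrier G"
  obtains w a where "reduced w" "a \<in> carrier A" "x = val w \<otimes>\<^bsub>G\<^esub> \<iota> a"
proof -
  let ?P = "\<lambda>x. \<exists>w a. reduced w \<and> a \<in> carrier A \<and> x = val w \<otimes>\<^bsub>G\<^esub> \<iota> a"
  have base: "?P (\<iota> b \<otimes>\<^bsub>G\<^esub> x)" if b: "b \<in> carrier A" and P: "?P x" for b x
  proof -
    obtain w a where w: "reduced w" and a: "a \<in> carrier A" and x: "x = val w \<otimes>\<^bsub>G\<^esub> \<iota> a"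
      using P by auto
    note wc = reduced_carrier[OF w]
    show ?thesis
    proof (cases w)
      case Nil
      then show ?thesis using a b x by (intro exI[of _ "[]"] exI[of _ "b \<otimes> a"]) simp
    next
      case (Cons y v)
      obtain g e where y: "y = (g, e)" by force
      have "reduced ((b \<otimes> g, e) # v)" using w b by (auto simp: Cons y reduced_Cons)
      moreover have "\<iota> b \<otimes>\<^bsub>G\<^esub> x = val ((b \<otimes> g, e) # v) \<otimes>\<^bsub>G\<^esub> \<iota> a"
        using wc a b by (simp add: x Cons y G.m_assoc)
      ultimately show ?thesis using a by blast
    qed
  qed
  have stab: "?P (stable e \<otimes>\<^bsub>G\<^esub> x)" if P: "?P x" for e x
  proof -
    obtain w a where w: "reduced w" and a: "a \<in> carrier A" and x: "x = val w \<otimes>\<^bsub>G\<^esub> \<iota> a"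
      using P by auto
    note wc = reduced_carrier[OF w]
    show ?thesis
    proof (cases "\<exists>g v. w = (g, \<not> e) # v \<and> g \<in> edge (\<not> e)")
      case True
      then obtain g v where v: "w = (g, \<not> e) # v" and g: "g \<in> edge (\<not> e)" by auto
      let ?b = "edge_map (\<not> e) g"
      have b: "?b \<in> carrier A" using edge_map_mem[OF g] edge_carrier by blast
      have "stable e \<otimes>\<^bsub>G\<^esub> x = (stable e \<otimes>\<^bsub>G\<^esub> (\<iota> g \<otimes>\<^bsub>G\<^esub> stable (\<not> e))) \<otimes>\<^bsub>G\<^esub> (val v \<otimes>\<^bsub>G\<^esub> \<iota> a)"
        using wc a g by (simp add: x v G.m_assoc)
      then have eq: "stable e \<otimes>\<^bsub>G\<^esub> x = \<iota> ?b \<otimes>\<^bsub>G\<^esub> (val v \<otimes>\<^bsub>G\<^esub> \<iota> a)"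
        using stable_conj_edge[OF g] by simp
      have "?P (val v \<otimes>\<^bsub>G\<^esub> \<iota> a)" using w a by (auto simp: v reduced_Cons)
      from base[OF b this] eq show ?thesis by simp
    next
      case False
      then have "reduced ((\<one>, e) # w)" using w by (auto simp: reduced_Cons)
      moreover have "stable e \<otimes>\<^bsub>G\<^esub> x = val ((\<one>, e) # w) \<otimes>\<^bsub>G\<^esub> \<iota> a"
        using wc a by (simp add: x G.m_assoc)
      ultimately show ?thesis using a by blast
    qed
  qed
  have "?P (cls u)" if "u \<in> hnn_words A" for u
    using that
  proof (induction u)
    case Nil
    show ?case by (intro exI[of _ "[]"] exI[of _ \<one>]) (simp add: one_cls[symmetric])
  next
    case (Cons l u)
    have eq: "cls (l # u) = cls [l] \<otimes>\<^bsub>G\<^esub> cls u"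
      using cls_mult[of "[l]" u] Cons.prems by simp
    have P: "?P (cls u)" using Cons by simp
    show ?case
    proof (cases l)
      case (Base a)
      then show ?thesis using base[OF _ P, of a] Cons.prems unfolding eq by (auto simp: hnn_base_def)
    next
      case Stable
      then show ?thesis using stab[OF P, of True] unfolding eq by (simp add: stable_def hnn_t_def)
    next
      case Stable_inv
      then show ?thesis using stab[OF P, of False] unfolding eq by (simp add: stable_def inv_t)
    qed
  qed
  then show ?thesis using assms that by (metis carrierE)
qed

section \<open>FC-elements of HNN extensions\<close>

lemma reduced_append:
  "reduced (v @ w) \<longleftrightarrow> reduced v \<and> reduced w \<and>
     (v = [] \<or> w = [] \<or> (snd (hd w) \<noteq> snd (last v) \<longrightarrow> fst (hd w) \<notin> edge (snd (hd w))))"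
  by (auto simp: reduced_def successively_append_iff case_prod_beta)

text \<open>No cancellation occurs when \<open>x = val s \<otimes> \<iota> b\<close> is conjugated by powers of \<open>t\<^sup>e\<close>, so the
  lengths of these conjugates are unbounded.\<close>

lemma infinite_conj_class:
  assumes red: "reduced ((\<one>, e) # s @ [(b, \<not> e)])"
  shows "infinite (conj_class G (val s \<otimes>\<^bsub>G\<^esub> \<iota> b))"
proof -
  define x where "x = val s \<otimes>\<^bsub>G\<^esub> \<iota> b"
  have s: "fst ` set s \<subseteq> carrier A" "b \<in> carrier A" using reduced_carrier[OF red] by auto
  then have x: "x \<in> carrier G" by (simp add: x_def)
  \<comment> \<open>Beginning with exponent \<open>e\<close> and ending with
    \<open>\<not> e\<close>, the sequence meets letters of equal sign when it is conjugated again,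
    so each round adds two letters without cancellation.\<close>
  let ?P = "\<lambda>k w. reduced w \<and> length w = k \<and> w \<noteq> [] \<and> snd (hd w) = e \<and>
    snd (last w) = (\<not> e) \<and> val w \<in> conj_class G x"
  have "\<exists>w. ?P (length s + 2 + 2 * k) w" for k
  proof (induction k)
    case 0
    have "val ((\<one>, e) # s @ [(b, \<not> e)]) = stable e \<otimes>\<^bsub>G\<^esub> x \<otimes>\<^bsub>G\<^esub> inv\<^bsub>G\<^esub> (stable e)"
      using s by (simp add: val_append x_def G.m_assoc inv_stable)
    then have "val ((\<one>, e) # s @ [(b, \<not> e)]) \<in> conj_class G x"
      using stable_closed by (auto simp: conj_class_def simp del: val.simps)
    then show ?case using red by (intro exI[of _ "(\<one>, e) # s @ [(b, \<not> e)]"]) (simp del: val.simps)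
  next
    case (Suc k)
    then obtain w where w: "?P (length s + 2 + 2 * k) w" by blast
    note wc = reduced_carrier[OF conjunct1[OF w]]
    let ?w = "[(\<one>, e)] @ w @ [(\<one>, \<not> e)]"
    have red': "reduced ?w"
      using w unfolding reduced_append by (auto simp: reduced_Cons)
    have "val ?w = stable e \<otimes>\<^bsub>G\<^esub> val w \<otimes>\<^bsub>G\<^esub> inv\<^bsub>G\<^esub> (stable e)"
      using wc by (simp add: val_append G.m_assoc inv_stable)
    then have "val ?w \<in> conj_class G x"
      using G.conj_class_closed[OF stable_closed x] w by (simp del: val.simps)
    then show ?case using red' w by (intro exI[of _ ?w]) (simp del: val.simps)
  qed
  then obtain w where w: "\<And>k. ?P (length s + 2 + 2 * k) (w k)" by metis
  have "inj (\<lambda>k. val (w k))"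
  proof (rule injI)
    fix k l assume "val (w k) = val (w l)"
    then have "length (w k) = length (w l)"
      using w[of k] w[of l] reduced_length_unique[of "w k" "w l" \<one> \<one>] by simp
    then show "k = l" using w[of k] w[of l] by simp
  qed
  moreover have "range (\<lambda>k. val (w k)) \<subseteq> conj_class G x" using w by auto
  ultimately show ?thesis
    using finite_subset range_inj_infinite unfolding x_def by blast
qed

section \<open>Powers of the stable letter\<close>

lemma val_replicate: "val (replicate k (\<one>, True)) = t [^]\<^bsub>G\<^esub> k"
proof (induction k)
  case (Suc k)
  then show ?case using t_carrier G.nat_pow_Suc2[OF t_carrier, of k] by (simp add: stable_def)
qed simp

text \<open>The power is the value of a reduced sequence of length \<open>k\<close>, whereas
  elements of \<open>A\<close> have length 0.\<close>

lemma nat_pow_t_base: "a \<in> carrier A \<Longrightarrow> t [^]\<^bsub>G\<^esub> (k::nat) = \<iota> a \<Longrightarrow> k = 0"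
proof -
  assume a: "a \<in> carrier A" "t [^]\<^bsub>G\<^esub> k = \<iota> a"
  have "reduced (replicate k (\<one>, True))" for k
  proof (induction k)
    case (Suc k)
    have "d = True" if "replicate k (\<one>, True) = (h, d) # w" for h d w
      using that by (cases k) auto
    then show ?case using Suc by (simp add: reduced_Cons) blast
  qed simp
  then have "length (replicate k (\<one>, True)) = length ([] :: ('a \<times> bool) list)"
    using a t_carrier by (intro reduced_length_unique[of _ _ \<one> a]) (simp_all add: val_replicate)
  then show "k = 0" by simp
qed

lemma int_pow_t_base:
  assumes "t [^]\<^bsub>G\<^esub> (n::int) \<in> \<iota> ` carrier A"
  shows "n = 0"
proof -
  obtain a where a: "a \<in> carrier A" "t [^]\<^bsub>G\<^esub> n = \<iota> a" using assms by auto
  show ?thesis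
  proof (cases "n < 0")
    case True
    then have "inv\<^bsub>G\<^esub> (t [^]\<^bsub>G\<^esub> nat (- n)) = \<iota> a"
      using a(2) unfolding int_pow_def2 by (simp only: if_True)
    then have "t [^]\<^bsub>G\<^esub> nat (- n) = inv\<^bsub>G\<^esub> (\<iota> a)"
      using G.inv_inv[OF G.nat_pow_closed[OF t_carrier]] by metis
    then have "t [^]\<^bsub>G\<^esub> nat (- n) = \<iota> (inv a)" using a(1) by simp
    from nat_pow_t_base[OF A.inv_closed[OF a(1)] this] True show ?thesis by simp
  next
    case False
    then have "t [^]\<^bsub>G\<^esub> nat n = \<iota> a"
      using a(2) unfolding int_pow_def2 by (simp only: if_False)
    from nat_pow_t_base[OF a(1) this] False show ?thesis by simp
  qed
qed

lemma infinite_HNN: "infinite (carrier G)"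
proof -
  have "inj (\<lambda>n::int. t [^]\<^bsub>G\<^esub> n)"
  proof (rule injI)
    fix m n :: int assume "t [^]\<^bsub>G\<^esub> m = t [^]\<^bsub>G\<^esub> n"
    then have "t [^]\<^bsub>G\<^esub> (m - n) = \<iota> \<one>" using t_carrier by (simp add: G.int_pow_diff)
    then have "m - n = 0" using A.one_closed by (intro int_pow_t_base) (metis imageI)
    then show "m = n" by simp
  qed
  moreover have "range (\<lambda>n::int. t [^]\<^bsub>G\<^esub> n) \<subseteq> carrier G" using t_carrier by auto
  ultimately show ?thesis using finite_subset range_inj_infinite by (metis finite_imageD infinite_UNIV_int)
qed

section \<open>The non-degenerate case\<close>

lemma FC_subset_base:
  assumes nondeg: "\<not> hnn_degenerate A C C'"
  shows "FC G (carrier G) \<subseteq> \<iota> ` (C \<inter> C')"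
proof (rule ccontr)
  assume "\<not> FC G (carrier G) \<subseteq> \<iota> ` (C \<inter> C')"
  then obtain x where x: "x \<in> carrier G" "finite (conj_class G x)" "x \<notin> \<iota> ` (C \<inter> C')"
    by (auto simp: FC_def)
  obtain w a where w: "reduced w" and a: "a \<in> carrier A" and xw: "x = val w \<otimes>\<^bsub>G\<^esub> \<iota> a"
    using reduced_form[OF x(1)] .
  show False
  proof (cases w)
    case Nil
    have "a \<notin> C \<inter> C'" using x(3) xw a Nil by auto
    \<comment> \<open>One of the two subgroups misses \<open>a\<close>; the sign is chosen so that
      conjugation by the stable letter does not absorb \<open>a\<close>.\<close>
    then have "a \<notin> edge (\<not> True) \<or> a \<notin> edge (\<not> False)" by (auto simp: edge_def)
    then obtain e where "a \<notin> edge (\<not> e)" by blast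
    then have "reduced ((\<one>, e) # [] @ [(a, \<not> e)])" using a by (auto simp: reduced_Cons)
    from infinite_conj_class[OF this] show False using x(2) xw Nil by simp
  next
    case (Cons y v)
    obtain g e1 where v: "w = (g, e1) # v" using Cons by (cases y) auto
    define e2 where "e2 = snd (last w)"
    have g: "g \<in> carrier A" using w v by (auto simp: reduced_Cons)
    \<comment> \<open>The conditions say that b x b^-1 can be enclosed between the letters with
      exponents \<open>e\<close> and \<open>\<not> e\<close> without cancellation on the left and on
      the right.\<close>
    have "\<exists>e b. b \<in> carrier A \<and> (e1 \<noteq> e \<longrightarrow> b \<otimes> g \<notin> edge e1) \<and>
      (e2 = e \<longrightarrow> a \<otimes> inv b \<notin> edge (\<not> e))"
    proof (cases "e1 = e2")
      case False
      then show ?thesis by (intro exI[of _ e1] exI[of _ \<one>]) auto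
    next
      case True
      \<comment> \<open>With equal exponents, one end is free by the choice of \<open>e\<close>. At
        the other, \<open>b\<close> turns the critical coefficient, \<open>b \<otimes> g\<close> or
        \<open>a \<otimes> inv b\<close>, into an element \<open>z\<close> outside an associated
        subgroup, which non-degeneracy provides.\<close>
      have "\<exists>f. edge f \<noteq> carrier A"
      proof (rule ccontr)
        assume "\<not> ?thesis"
        then have "C = carrier A" "C' = carrier A"
          using edge_def[of True] edge_def[of False] by simp_all
        then show False using nondeg by (simp add: hnn_degenerate_def)
      qed
      then obtain f z where z: "z \<in> carrier A" "z \<notin> edge f" using edge_carrier by blast
      show ?thesis
      proof (cases "f = e1")
        case True
        have "(z \<otimes> inv g) \<otimes> g = z" using z g by (simp add: A.m_assoc)
        then show ?thesis using True \<open>e1 = e2\<close> z g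
          by (intro exI[of _ "\<not> e1"] exI[of _ "z \<otimes> inv g"]) auto
      next
        case False
        have "a \<otimes> inv (inv z \<otimes> a) = z"
          using z a by (simp add: A.inv_mult_group A.inv_cancel_left)
        moreover have "f = (\<not> e1)" using False by auto
        ultimately show ?thesis using z a
          by (intro exI[of _ e1] exI[of _ "inv z \<otimes> a"]) auto
      qed
    qed
    then obtain e b where b: "b \<in> carrier A" and be1: "e1 \<noteq> e \<Longrightarrow> b \<otimes> g \<notin> edge e1"
      and be2: "e2 = e \<Longrightarrow> a \<otimes> inv b \<notin> edge (\<not> e)" by blast
    define w' where "w' = (b \<otimes> g, e1) # v"
    have w': "reduced w'" using w b by (auto simp: v w'_def reduced_Cons)
    have last: "snd (last w') = e2" by (simp add: w'_def e2_def v)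
    have "reduced ([(\<one>, e)] @ w' @ [(a \<otimes> inv b, \<not> e)])"
      unfolding reduced_append using w' last a b be1 be2 by (auto simp: reduced_Cons w'_def)
    then have "infinite (conj_class G (val w' \<otimes>\<^bsub>G\<^esub> \<iota> (a \<otimes> inv b)))"
      using infinite_conj_class by simp
    moreover have "val w' \<otimes>\<^bsub>G\<^esub> \<iota> (a \<otimes> inv b) = \<iota> b \<otimes>\<^bsub>G\<^esub> x \<otimes>\<^bsub>G\<^esub> inv\<^bsub>G\<^esub> (\<iota> b)"
      using reduced_carrier[OF w] a b by (simp add: xw v w'_def G.m_assoc)
    ultimately show False using G.conj_class_conj[of "\<iota> b" x] x b by simp
  qed
qed

lemma core_subset: "hnn_core A C C' \<phi> \<subseteq> carrier G"
  using hnn_core_greatest(1) by (rule normal_imp_subgroup[THEN subgroup.subset])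

lemma one_in_core: "\<one>\<^bsub>G\<^esub> \<in> hnn_core A C C' \<phi>"
  using hnn_core_greatest(1) by (rule normal_imp_subgroup[THEN subgroup.one_closed])

lemma icc_imp_FC_core: "icc G \<Longrightarrow> FC G (hnn_core A C C' \<phi>) = {\<one>\<^bsub>G\<^esub>}"
  using core_subset one_in_core G.conj_class_one by (auto simp: icc_def FC_def)

lemma icc_nondegenerate:
  assumes "\<not> hnn_degenerate A C C'"
  shows "icc G \<longleftrightarrow> FC G (hnn_core A C C' \<phi>) = {\<one>\<^bsub>G\<^esub>}"
proof
  assume FC: "FC G (hnn_core A C C' \<phi>) = {\<one>\<^bsub>G\<^esub>}"
  have "FC G (carrier G) \<subseteq> hnn_core A C C' \<phi>"
    by (rule hnn_core_greatest(3)[OF G.FC_normal FC_subset_base[OF assms]])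
  then have "FC G (carrier G) = FC G (hnn_core A C C' \<phi>)"
    using core_subset by (auto simp: FC_def)
  then show "icc G" using infinite_HNN FC by (simp add: G.icc_iff_FC)
qed (rule icc_imp_FC_core)

section \<open>The degenerate case\<close>

lemma core_degenerate:
  assumes "hnn_degenerate A C C'"
  shows "hnn_core A C C' \<phi> = \<iota> ` carrier A"
proof
  have "C \<inter> C' = carrier A" using assms by (auto simp: hnn_degenerate_def)
  then show "hnn_core A C C' \<phi> \<subseteq> \<iota> ` carrier A" "\<iota> ` carrier A \<subseteq> hnn_core A C C' \<phi>"
    using hnn_core_greatest(2) hnn_core_greatest(3)[OF base_normal[OF assms]] by simp_all
qed

text \<open>As \<open>A\<close> is normal, a power of t can be moved to the right past an element of
  \<open>A\<close> at the price of conjugating that element.\<close>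

lemma degenerate_form:
  assumes deg: "hnn_degenerate A C C'" and x: "x \<in> carrier G"
  obtains b n where "b \<in> \<iota> ` carrier A" "x = b \<otimes>\<^bsub>G\<^esub> t [^]\<^bsub>G\<^esub> (n::int)"
proof -
  let ?B = "\<iota> ` carrier A"
  note nB = base_normal[OF deg]
  have B: "subgroup ?B G" by (rule normal_imp_subgroup[OF nB])
  let ?P = "\<lambda>x. \<exists>b (n::int). b \<in> ?B \<and> x = b \<otimes>\<^bsub>G\<^esub> t [^]\<^bsub>G\<^esub> n"
  have stab: "?P (t [^]\<^bsub>G\<^esub> (m::int) \<otimes>\<^bsub>G\<^esub> x)" if "?P x" for m x
  proof -
    obtain b n where b: "b \<in> ?B" "x = b \<otimes>\<^bsub>G\<^esub> t [^]\<^bsub>G\<^esub> (n::int)" using \<open>?P x\<close> by blast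
    have bG: "b \<in> carrier G" using b(1) by auto
    let ?c = "t [^]\<^bsub>G\<^esub> m \<otimes>\<^bsub>G\<^esub> b \<otimes>\<^bsub>G\<^esub> inv\<^bsub>G\<^esub> (t [^]\<^bsub>G\<^esub> m)"
    have "?c \<in> ?B" using G.normal_invE(2)[OF nB _ b(1)] t_carrier by blast
    moreover have "t [^]\<^bsub>G\<^esub> m \<otimes>\<^bsub>G\<^esub> x = ?c \<otimes>\<^bsub>G\<^esub> t [^]\<^bsub>G\<^esub> (m + n)"
      using bG t_carrier by (simp add: b(2) G.int_pow_mult G.m_assoc G.inv_cancel_left)
    ultimately show ?thesis by blast
  qed
  have base: "?P (c \<otimes>\<^bsub>G\<^esub> x)" if "?P x" "c \<in> ?B" for c x
  proof -
    obtain b n where b: "b \<in> ?B" "x = b \<otimes>\<^bsub>G\<^esub> t [^]\<^bsub>G\<^esub> (n::int)" using \<open>?P x\<close> by blast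
    then have "c \<otimes>\<^bsub>G\<^esub> x = (c \<otimes>\<^bsub>G\<^esub> b) \<otimes>\<^bsub>G\<^esub> t [^]\<^bsub>G\<^esub> n"
      using that(2) t_carrier by (auto simp: G.m_assoc)
    then show ?thesis using subgroup.m_closed[OF B that(2) b(1)] by blast
  qed
  have val: "?P (val w \<otimes>\<^bsub>G\<^esub> \<iota> a)" if "fst ` set w \<subseteq> carrier A" "a \<in> carrier A" for w a
    using that
  proof (induction w)
    case Nil
    then show ?case by (intro exI[of _ "\<iota> a"] exI[of _ 0]) auto
  next
    case (Cons y w)
    obtain b e where y: "y = (b, e)" by force
    have b: "b \<in> carrier A" and w: "fst ` set w \<subseteq> carrier A" using Cons.prems y by auto
    have "stable e = t [^]\<^bsub>G\<^esub> (if e then 1 else - 1 :: int)"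
      using t_carrier G.int_pow_neg[of t 1] by (simp add: stable_def)
    then have "?P (stable e \<otimes>\<^bsub>G\<^esub> (val w \<otimes>\<^bsub>G\<^esub> \<iota> a))"
      using stab[OF Cons.IH[OF w Cons.prems(2)]] by metis
    from base[OF this, of "\<iota> b"] b w Cons.prems(2) show ?case by (simp add: y G.m_assoc)
  qed
  obtain w a where "reduced w" "a \<in> carrier A" "x = val w \<otimes>\<^bsub>G\<^esub> \<iota> a"
    using reduced_form[OF x] .
  with val[of w a] that show ?thesis using reduced_carrier by metis
qed

text \<open>Injectivity of a homomorphism is triviality of its kernel, which
  \<open>outer_action_eq_one_iff\<close> describes inside \<open>G\<close>.\<close>

lemma inj_Theta_iff:
  assumes deg: "hnn_degenerate A C C'"
  shows "inj (hnn_Theta A C \<phi>) \<longleftrightarrow>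
    (\<forall>n::int. \<forall>b \<in> \<iota> ` carrier A.
      (\<forall>y \<in> \<iota> ` carrier A. t [^]\<^bsub>G\<^esub> n \<otimes>\<^bsub>G\<^esub> y \<otimes>\<^bsub>G\<^esub> inv\<^bsub>G\<^esub> (t [^]\<^bsub>G\<^esub> n) =
        b \<otimes>\<^bsub>G\<^esub> y \<otimes>\<^bsub>G\<^esub> inv\<^bsub>G\<^esub> b) \<longrightarrow> n = 0)"
proof -
  interpret B: group "hnn_base_group A C \<phi>"
    unfolding hnn_base_group_def
    by (rule G.subgroup_imp_group[OF normal_imp_subgroup[OF base_normal[OF deg]]])
  have Out: "group (Out (hnn_base_group A C \<phi>))"
    unfolding Out_def by (rule normal.factorgroup_is_group[OF B.Inn_normal])
  interpret Th: group_hom integer_group "Out (hnn_base_group A C \<phi>)" "hnn_Theta A C \<phi>"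
    by (rule group_hom.intro) (use Out hnn_Theta_hom[OF deg] in \<open>auto simp: group_hom_axioms_def\<close>)
  have "hnn_Theta A C \<phi> n = \<one>\<^bsub>Out (hnn_base_group A C \<phi>)\<^esub> \<longleftrightarrow>
    (\<exists>b \<in> \<iota> ` carrier A. \<forall>y \<in> \<iota> ` carrier A.
      t [^]\<^bsub>G\<^esub> n \<otimes>\<^bsub>G\<^esub> y \<otimes>\<^bsub>G\<^esub> inv\<^bsub>G\<^esub> (t [^]\<^bsub>G\<^esub> n) = b \<otimes>\<^bsub>G\<^esub> y \<otimes>\<^bsub>G\<^esub> inv\<^bsub>G\<^esub> b)" for n
    unfolding hnn_Theta_def hnn_base_group_def
    by (rule G.outer_action_eq_one_iff[OF base_normal[OF deg]]) (simp add: t_carrier)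
  then show ?thesis using Th.inj_on_one_iff by auto
qed

lemma icc_degenerate:
  assumes deg: "hnn_degenerate A C C'"
  shows "icc G \<longleftrightarrow> FC G (hnn_core A C C' \<phi>) = {\<one>\<^bsub>G\<^esub>} \<and> inj (hnn_Theta A C \<phi>)"
proof -
  let ?B = "\<iota> ` carrier A"
  note nB = base_normal[OF deg] and core = core_degenerate[OF deg]
  have B: "subgroup ?B G" by (rule normal_imp_subgroup[OF nB])
  note BG = subgroup.mem_carrier[OF B]
  have "n = 0" if icc: "icc G" and \<alpha>: "\<alpha> \<in> ?B" and inner: "\<And>y. y \<in> ?B \<Longrightarrow>
    t [^]\<^bsub>G\<^esub> n \<otimes>\<^bsub>G\<^esub> y \<otimes>\<^bsub>G\<^esub> inv\<^bsub>G\<^esub> (t [^]\<^bsub>G\<^esub> n) = \<alpha> \<otimes>\<^bsub>G\<^esub> y \<otimes>\<^bsub>G\<^esub> inv\<^bsub>G\<^esub> \<alpha>" for n :: int and \<alpha>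
  proof (rule ccontr)
    assume n: "n \<noteq> 0"
    define h where "h = t [^]\<^bsub>G\<^esub> n"
    \<comment> \<open>Dividing t^n by the element that induces the same automorphism gives an
      element centralising \<open>A\<close>.\<close>
    define g where "g = inv\<^bsub>G\<^esub> \<alpha> \<otimes>\<^bsub>G\<^esub> h"
    have h: "h \<in> carrier G" and \<alpha>G: "\<alpha> \<in> carrier G" using t_carrier BG[OF \<alpha>] by (auto simp: h_def)
    then have g: "g \<in> carrier G" and \<alpha>g: "\<alpha> \<otimes>\<^bsub>G\<^esub> g = h" by (simp_all add: g_def G.inv_cancel_left)
    have comm: "y \<otimes>\<^bsub>G\<^esub> g = g \<otimes>\<^bsub>G\<^esub> y" if "y \<in> ?B" for y
    proof -
      have y: "y \<in> carrier G" by (rule BG[OF that])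
      have "h \<otimes>\<^bsub>G\<^esub> y = (h \<otimes>\<^bsub>G\<^esub> y \<otimes>\<^bsub>G\<^esub> inv\<^bsub>G\<^esub> h) \<otimes>\<^bsub>G\<^esub> h" using h y by (simp add: G.m_assoc)
      also have "\<dots> = \<alpha> \<otimes>\<^bsub>G\<^esub> (y \<otimes>\<^bsub>G\<^esub> g)"
        using inner[OF that] \<alpha>G h y by (simp add: g_def G.m_assoc flip: h_def)
      finally have "inv\<^bsub>G\<^esub> \<alpha> \<otimes>\<^bsub>G\<^esub> (h \<otimes>\<^bsub>G\<^esub> y) = y \<otimes>\<^bsub>G\<^esub> g"
        using \<alpha>G g y by (simp add: G.inv_cancel_left)
      then show ?thesis using \<alpha>G h y by (simp add: g_def G.m_assoc)
    qed
    \<comment> \<open>\<open>h\<close> is the product of \<open>\<alpha>\<close>, which lies in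
      \<open>A\<close>, and \<open>g\<close>; both factors commute with \<open>g\<close>.\<close>
    have hg: "h \<otimes>\<^bsub>G\<^esub> g = g \<otimes>\<^bsub>G\<^esub> h"
      using comm[OF \<alpha>] \<alpha>G g by (simp add: G.m_assoc flip: \<alpha>g)
    have "conj_class G g \<subseteq>
      (\<lambda>r::int. t [^]\<^bsub>G\<^esub> r \<otimes>\<^bsub>G\<^esub> g \<otimes>\<^bsub>G\<^esub> inv\<^bsub>G\<^esub> (t [^]\<^bsub>G\<^esub> r)) ` {- \<bar>n\<bar>..\<bar>n\<bar>}"
    proof
      fix z assume "z \<in> conj_class G g"
      then obtain x where x: "x \<in> carrier G" "z = x \<otimes>\<^bsub>G\<^esub> g \<otimes>\<^bsub>G\<^esub> inv\<^bsub>G\<^esub> x"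
        by (auto simp: conj_class_def)
      \<comment> \<open>Decomposing \<open>inv x\<close> instead of \<open>x\<close> puts the factor
        from \<open>A\<close> to the right of the power of t.\<close>
      obtain b m where b: "b \<in> ?B" "inv\<^bsub>G\<^esub> x = b \<otimes>\<^bsub>G\<^esub> t [^]\<^bsub>G\<^esub> (m::int)"
        using degenerate_form[OF deg G.inv_closed[OF x(1)]] .
      define c where "c = inv\<^bsub>G\<^esub> b"
      \<comment> \<open>Division by \<open>n\<close> splits off a power of \<open>h\<close>;
        together with \<open>c\<close> it commutes with \<open>g\<close>, so only \<open>r\<close>
        affects the conjugate.\<close>
      define q r where "q = (- m) div n" and "r = (- m) mod n"
      have c: "c \<in> ?B" using subgroup.m_inv_closed[OF B b(1)] by (simp add: c_def)
      then have cG: "c \<in> carrier G" by (rule BG)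
      have hq: "h [^]\<^bsub>G\<^esub> q \<in> carrier G" "t [^]\<^bsub>G\<^esub> r \<in> carrier G" using h t_carrier by auto
      have "x = inv\<^bsub>G\<^esub> (b \<otimes>\<^bsub>G\<^esub> t [^]\<^bsub>G\<^esub> m)" using b(2) x(1) G.inv_inv by metis
      then have "x = t [^]\<^bsub>G\<^esub> (- m) \<otimes>\<^bsub>G\<^esub> c"
        using BG[OF b(1)] t_carrier by (simp add: c_def G.inv_mult_group G.int_pow_neg)
      moreover have "- m = r + n * q" by (simp add: q_def r_def)
      ultimately have xe: "x = t [^]\<^bsub>G\<^esub> r \<otimes>\<^bsub>G\<^esub> (h [^]\<^bsub>G\<^esub> q \<otimes>\<^bsub>G\<^esub> c)"
        using t_carrier cG by (simp add: G.int_pow_mult G.int_pow_pow h_def G.m_assoc)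
      have "(h [^]\<^bsub>G\<^esub> q \<otimes>\<^bsub>G\<^esub> c) \<otimes>\<^bsub>G\<^esub> g = g \<otimes>\<^bsub>G\<^esub> (h [^]\<^bsub>G\<^esub> q \<otimes>\<^bsub>G\<^esub> c)"
      proof -
        have "(h [^]\<^bsub>G\<^esub> q \<otimes>\<^bsub>G\<^esub> c) \<otimes>\<^bsub>G\<^esub> g = (h [^]\<^bsub>G\<^esub> q \<otimes>\<^bsub>G\<^esub> g) \<otimes>\<^bsub>G\<^esub> c"
          using comm[OF c] cG g hq by (simp add: G.m_assoc)
        then show ?thesis
          using G.commutes_int_pow[OF hg h g, of q] cG g hq by (simp add: G.m_assoc)
      qed
      then have "x \<otimes>\<^bsub>G\<^esub> g = t [^]\<^bsub>G\<^esub> r \<otimes>\<^bsub>G\<^esub> g \<otimes>\<^bsub>G\<^esub> (h [^]\<^bsub>G\<^esub> q \<otimes>\<^bsub>G\<^esub> c)"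
        using cG g hq by (simp add: xe G.m_assoc)
      then have "z = t [^]\<^bsub>G\<^esub> r \<otimes>\<^bsub>G\<^esub> g \<otimes>\<^bsub>G\<^esub> inv\<^bsub>G\<^esub> (t [^]\<^bsub>G\<^esub> r)"
        using cG g hq by (simp add: x(2)) (simp add: xe G.m_assoc G.inv_mult_group G.inv_cancel_left)
      \<comment> \<open>The sign of the remainder depends on that of \<open>n\<close>, hence the
        symmetric range.\<close>
      moreover have "r \<in> {- \<bar>n\<bar>..\<bar>n\<bar>}" using abs_mod_less[OF n, of "- m"] by (auto simp: r_def)
      ultimately show "z \<in> (\<lambda>r::int. t [^]\<^bsub>G\<^esub> r \<otimes>\<^bsub>G\<^esub> g \<otimes>\<^bsub>G\<^esub> inv\<^bsub>G\<^esub> (t [^]\<^bsub>G\<^esub> r)) ` {- \<bar>n\<bar>..\<bar>n\<bar>}"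
        by blast
    qed
    then have "finite (conj_class G g)" using finite_subset by blast
    then have "g = \<one>\<^bsub>G\<^esub>" using icc g by (auto simp: icc_def)
    then have "t [^]\<^bsub>G\<^esub> n \<in> ?B" using \<alpha> \<alpha>g \<alpha>G by (simp add: h_def)
    then show False using int_pow_t_base n by blast
  qed
  then have inj: "inj (hnn_Theta A C \<phi>)" if "icc G"
    using that unfolding inj_Theta_iff[OF deg] by blast
  have "FC G (carrier G) = {\<one>\<^bsub>G\<^esub>}"
    if FC: "FC G (hnn_core A C C' \<phi>) = {\<one>\<^bsub>G\<^esub>}" and inj: "inj (hnn_Theta A C \<phi>)"
  proof -
    have FCB: "x = \<one>\<^bsub>G\<^esub>" if "x \<in> FC G (carrier G)" "x \<in> ?B" for x
      using that FC by (auto simp: core FC_def)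
    have sFC: "subgroup (FC G (carrier G)) G" by (rule normal_imp_subgroup[OF G.FC_normal])
    have "x = \<one>\<^bsub>G\<^esub>" if x: "x \<in> FC G (carrier G)" for x
    proof -
      have xG: "x \<in> carrier G" using x by (simp add: FC_def)
      obtain b n where b: "b \<in> ?B" and xb: "x = b \<otimes>\<^bsub>G\<^esub> t [^]\<^bsub>G\<^esub> (n::int)"
        using degenerate_form[OF deg xG] .
      have bG: "b \<in> carrier G" by (rule BG[OF b])
      have th: "t [^]\<^bsub>G\<^esub> n = inv\<^bsub>G\<^esub> b \<otimes>\<^bsub>G\<^esub> x" using bG t_carrier by (simp add: xb G.inv_cancel_left)
      have "t [^]\<^bsub>G\<^esub> n \<otimes>\<^bsub>G\<^esub> y \<otimes>\<^bsub>G\<^esub> inv\<^bsub>G\<^esub> (t [^]\<^bsub>G\<^esub> n) =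
          inv\<^bsub>G\<^esub> b \<otimes>\<^bsub>G\<^esub> y \<otimes>\<^bsub>G\<^esub> inv\<^bsub>G\<^esub> (inv\<^bsub>G\<^esub> b)" if y: "y \<in> ?B" for y
      proof -
        have yG: "y \<in> carrier G" by (rule BG[OF y])
        \<comment> \<open>The commutator of \<open>y\<close> and \<open>x\<close> is an FC-element
          in this bracketing and an element of \<open>A\<close> in the next one, hence
          trivial.\<close>
        have "(y \<otimes>\<^bsub>G\<^esub> x \<otimes>\<^bsub>G\<^esub> inv\<^bsub>G\<^esub> y) \<otimes>\<^bsub>G\<^esub> inv\<^bsub>G\<^esub> x \<in> FC G (carrier G)"
          by (rule subgroup.m_closed[OF sFC G.normal_invE(2)[OF G.FC_normal yG x]
                subgroup.m_inv_closed[OF sFC x]])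
        moreover have "y \<otimes>\<^bsub>G\<^esub> (x \<otimes>\<^bsub>G\<^esub> inv\<^bsub>G\<^esub> y \<otimes>\<^bsub>G\<^esub> inv\<^bsub>G\<^esub> x) \<in> ?B"
          by (rule subgroup.m_closed[OF B y
                G.normal_invE(2)[OF nB xG subgroup.m_inv_closed[OF B y]]])
        ultimately have "(y \<otimes>\<^bsub>G\<^esub> x \<otimes>\<^bsub>G\<^esub> inv\<^bsub>G\<^esub> y) \<otimes>\<^bsub>G\<^esub> inv\<^bsub>G\<^esub> x = \<one>\<^bsub>G\<^esub>"
          using xG yG by (intro FCB) (simp_all add: G.m_assoc)
        then have "y \<otimes>\<^bsub>G\<^esub> x \<otimes>\<^bsub>G\<^esub> inv\<^bsub>G\<^esub> y = x"
          using xG yG G.inv_equality[of "y \<otimes>\<^bsub>G\<^esub> x \<otimes>\<^bsub>G\<^esub> inv\<^bsub>G\<^esub> y" "inv\<^bsub>G\<^esub> x"] by simp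
        then have "x \<otimes>\<^bsub>G\<^esub> y = y \<otimes>\<^bsub>G\<^esub> x"
          using xG yG G.inv_solve_right[of x "y \<otimes>\<^bsub>G\<^esub> x" y] by simp
        then have "x \<otimes>\<^bsub>G\<^esub> y \<otimes>\<^bsub>G\<^esub> inv\<^bsub>G\<^esub> x = y" using xG yG by (simp add: G.m_assoc)
        moreover have "t [^]\<^bsub>G\<^esub> n \<otimes>\<^bsub>G\<^esub> y \<otimes>\<^bsub>G\<^esub> inv\<^bsub>G\<^esub> (t [^]\<^bsub>G\<^esub> n) =
            inv\<^bsub>G\<^esub> b \<otimes>\<^bsub>G\<^esub> (x \<otimes>\<^bsub>G\<^esub> y \<otimes>\<^bsub>G\<^esub> inv\<^bsub>G\<^esub> x) \<otimes>\<^bsub>G\<^esub> b"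
          using xG yG bG by (simp add: th G.m_assoc G.inv_mult_group)
        ultimately show ?thesis using bG by simp
      qed
      \<comment> \<open>Injectivity is applied with \<open>inv b\<close> as the element inducing the
        action; afterwards \<open>x\<close> equals \<open>b\<close> and lies in
        \<open>A\<close>.\<close>
      then have "n = 0"
        by (intro inj[unfolded inj_Theta_iff[OF deg], THEN spec, THEN bspec, THEN mp,
              OF subgroup.m_inv_closed[OF B b]] ballI)
      then show ?thesis using FCB[OF x] b xb bG by simp
    qed
    then show ?thesis using subgroup.one_closed[OF sFC] by blast
  qed
  then show ?thesis using inj icc_imp_FC_core infinite_HNN by (auto simp: G.icc_iff_FC)
qed

end

theorem proposition5p12:
  fixes A :: "('a, 'm) monoid_scheme" and C C' :: "'a set" and \<phi> :: "'a \<Rightarrow> 'a"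
  assumes "group A" and "carrier A \<noteq> {\<one>\<^bsub>A\<^esub>}"
    and "subgroup C A" and "subgroup C' A"
    and "\<phi> \<in> iso (A\<lparr>carrier := C\<rparr>) (A\<lparr>carrier := C'\<rparr>)"
  shows "(\<not> hnn_degenerate A C C' \<longrightarrow>
            (icc (HNN A C \<phi>) \<longleftrightarrow>
               FC (HNN A C \<phi>) (hnn_core A C C' \<phi>) = {\<one>\<^bsub>HNN A C \<phi>\<^esub>})) \<and>
         (hnn_degenerate A C C' \<longrightarrow>
            (icc (HNN A C \<phi>) \<longleftrightarrow>
               FC (HNN A C \<phi>) (hnn_core A C C' \<phi>) = {\<one>\<^bsub>HNN A C \<phi>\<^esub>} \<and>
               inj (hnn_Theta A C \<phi>)))"
proof -
  interpret hnn_data A C C' \<phi>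
    using assms by (intro hnn_data.intro hnn_data_axioms.intro)
  show ?thesis using icc_nondegenerate icc_degenerate by blast
qed

end
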